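(* For all integers $n\ge 2$, $$d_{SK}(E_1^n)\ \ge\ \frac{n}{2\sqrt{n-1}}.$$ Hence in particular $d_{SK}(E_1^n)>1$ for all $n\ge 3$.
   Context: An operator space is a closed subspace $E\subset B(H)$, $H$ a complex Hilbert space, with the norms on $M_n(E)$ induced by $B(\ell_2^n(H))$. For linear $u:E\to F$, $\|u\|_{cb}=\sup_{n\ge1}\|I_{M_n}\otimes u\|_{M_n(E)\to M_n(F)}$. For operator spaces $E,F$, $d_{cb}(E,F)=\inf\{\|u\|_{cb}\|u^{-1}\|_{cb}\}$ over all isomorphisms $u:E\to F$ ($=\infty$ if there is no complete isomorphism). Let $K=K(\ell_2)$ be the space of compact operators on $\ell_2$, and $$d_{SK}(E)=\inf\{d_{cb}(E,F)\mid F\subset K\text{ a closed subspace}\};$$ for finite dimensional $E$ this equals $\inf\{d_{cb}(E,F)\mid F\subset M_k,\ k\ge1\}$. The dual $E^*$ of an operator space $E$ carries the dual operator space structure $M_n(E^* )=cb(E,M_n)$ (isometrically). The space $\ell_\infty^n$ has its natural structure (diagonal matrices in $M_n$), and $E_1^n=(\ell_\infty^n)^*$ is its operator space dual. As a Banach space $E_1^n$ is $\ell_1^n$, and its canonical basis $e_1,\dots,e_n$ satisfies, for all $a_1,\dots,a_n\in B=B(\ell_2)$, $\|\sum e_i\otimes a_i\|_{E_1^n\otimes_{\min}B}=\sup\|\sum u_i\otimes a_i\|_{B\otimes_{\min}B}$, the supremum being over all unitaries $u_1,\dots,u_n\in B$, where $\otimes_{\min}$ is the minimal (spatial) tensor product.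 *)

theory Defs
  imports "HOL-Analysis.Analysis" "HOL-Library.Function_Algebras"
begin

section \<open>Complex vector spaces\<close>

class complex_vector = ab_group_add +
  fixes scaleC :: "complex \<Rightarrow> 'a \<Rightarrow> 'a"  (infixr \<open>*\<^sub>C\<close> 75)
  assumes scaleC_add_right: "c *\<^sub>C (x + y) = c *\<^sub>C x + c *\<^sub>C y"
    and scaleC_add_left: "(c + d) *\<^sub>C x = c *\<^sub>C x + d *\<^sub>C x"
    and scaleC_scaleC: "c *\<^sub>C (d *\<^sub>C x) = (c * d) *\<^sub>C x"
    and scaleC_one: "1 *\<^sub>C x = x"

class complex_normed_vector = complex_vector + real_normed_vector +
  assumes scaleR_scaleC: "r *\<^sub>R x = complex_of_real r *\<^sub>C x"
    and norm_scaleC: "norm (c *\<^sub>C x) = cmod c * norm x"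

definition csubspace :: "'a::complex_vector set \<Rightarrow> bool" where
  "csubspace S \<longleftrightarrow> 0 \<in> S \<and> (\<forall>x\<in>S. \<forall>y\<in>S. x + y \<in> S) \<and> (\<forall>c. \<forall>x\<in>S. c *\<^sub>C x \<in> S)"

definition clinear_on :: "'a::complex_vector set \<Rightarrow> ('a \<Rightarrow> 'b::complex_vector) \<Rightarrow> bool" where
  "clinear_on S f \<longleftrightarrow>
     (\<forall>x\<in>S. \<forall>y\<in>S. f (x + y) = f x + f y) \<and> (\<forall>c. \<forall>x\<in>S. f (c *\<^sub>C x) = c *\<^sub>C f x)"

instantiation complex :: complex_normed_vector
begin
definition scaleC_complex :: "complex \<Rightarrow> complex \<Rightarrow> complex" where
  "scaleC_complex c x = c * x"
instance
  by standard (simp_all add: scaleC_complex_def algebra_simps norm_mult scaleR_conv_of_real)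
end

instantiation "fun" :: (type, complex_vector) complex_vector
begin
definition scaleC_fun :: "complex \<Rightarrow> ('a \<Rightarrow> 'b) \<Rightarrow> 'a \<Rightarrow> 'b" where
  "scaleC_fun c f = (\<lambda>x. c *\<^sub>C f x)"
instance
  by standard
    (simp_all add: scaleC_fun_def fun_eq_iff scaleC_add_right scaleC_add_left scaleC_scaleC scaleC_one)
end

lemma bounded_linear_scaleC:
  fixes f :: "'a::real_normed_vector \<Rightarrow> 'b::complex_normed_vector"
  assumes "bounded_linear f"
  shows "bounded_linear (\<lambda>x. c *\<^sub>C f x)"
proof -
  interpret f: bounded_linear f by fact
  obtain K where K: "\<And>x. norm (f x) \<le> norm x * K" using f.bounded by blast
  show ?thesis
  proof (rule bounded_linear_intro[where K = "cmod c * K"])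
    show "c *\<^sub>C f (x + y) = c *\<^sub>C f x + c *\<^sub>C f y" for x y
      by (simp add: f.add scaleC_add_right)
    show "c *\<^sub>C f (r *\<^sub>R x) = r *\<^sub>R (c *\<^sub>C f x)" for r x
      by (simp add: f.scaleR scaleR_scaleC scaleC_scaleC mult.commute)
    show "norm (c *\<^sub>C f x) \<le> norm x * (cmod c * K)" for x
      using mult_left_mono[OF K[of x] norm_ge_zero[of c]] by (simp add: norm_scaleC mult_ac)
  qed
qed

instantiation blinfun :: (real_normed_vector, complex_normed_vector) complex_vector
begin
lift_definition scaleC_blinfun :: "complex \<Rightarrow> 'a \<Rightarrow>\<^sub>L 'b \<Rightarrow> 'a \<Rightarrow>\<^sub>L 'b" is "\<lambda>c f x. c *\<^sub>C f x"
  by (rule bounded_linear_scaleC)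
instance
  by standard
    (transfer; simp add: fun_eq_iff scaleC_add_right scaleC_add_left scaleC_scaleC scaleC_one)+
end


section \<open>The Hilbert space \<open>\<ell>\<^sub>2\<close> and its compact operators\<close>

typedef ell2 = "{x :: nat \<Rightarrow> complex. summable (\<lambda>i. (cmod (x i))\<^sup>2)}"
  morphisms ell2_nth Abs_ell2
  by (rule exI[of _ "\<lambda>_. 0"]) simp

setup_lifting type_definition_ell2

lemma ell2_triangle:
  fixes x y :: "nat \<Rightarrow> complex"
  assumes x: "summable (\<lambda>i. (cmod (x i))\<^sup>2)" and y: "summable (\<lambda>i. (cmod (y i))\<^sup>2)"
  shows "summable (\<lambda>i. (cmod (x i + y i))\<^sup>2)"
    and "sqrt (\<Sum>i. (cmod (x i + y i))\<^sup>2) \<le> sqrt (\<Sum>i. (cmod (x i))\<^sup>2) + sqrt (\<Sum>i. (cmod (y i))\<^sup>2)"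
proof -
  let ?R = "sqrt (\<Sum>i. (cmod (x i))\<^sup>2) + sqrt (\<Sum>i. (cmod (y i))\<^sup>2)"
  have R0: "0 \<le> ?R" by (intro add_nonneg_nonneg real_sqrt_ge_zero suminf_nonneg x y) auto
  have part: "(\<Sum>i<n. (cmod (x i + y i))\<^sup>2) \<le> ?R\<^sup>2" for n
  proof -
    have "L2_set (\<lambda>i. cmod (x i + y i)) {..<n} \<le> L2_set (\<lambda>i. cmod (x i) + cmod (y i)) {..<n}"
      by (intro L2_set_mono norm_triangle_ineq) auto
    also have "\<dots> \<le> L2_set (\<lambda>i. cmod (x i)) {..<n} + L2_set (\<lambda>i. cmod (y i)) {..<n}"
      by (rule L2_set_triangle_ineq)
    also have "\<dots> \<le> ?R"
      unfolding L2_set_def by (intro add_mono real_sqrt_le_mono sum_le_suminf x y) auto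
    finally have "sqrt (\<Sum>i<n. (cmod (x i + y i))\<^sup>2) \<le> ?R" by (simp add: L2_set_def)
    then show ?thesis by (rule sqrt_le_D)
  qed
  show s: "summable (\<lambda>i. (cmod (x i + y i))\<^sup>2)"
    by (rule summableI_nonneg_bounded[of _ "?R\<^sup>2"]) (use part in auto)
  have "(\<Sum>i. (cmod (x i + y i))\<^sup>2) \<le> ?R\<^sup>2" by (rule suminf_le_const[OF s part])
  then show "sqrt (\<Sum>i. (cmod (x i + y i))\<^sup>2) \<le> ?R" using R0 by (rule real_le_lsqrt[rotated])
qed

instantiation ell2 :: complex_normed_vector
begin

lift_definition zero_ell2 :: ell2 is "\<lambda>_. 0" by simp
lift_definition plus_ell2 :: "ell2 \<Rightarrow> ell2 \<Rightarrow> ell2" is "\<lambda>x y i. x i + y i"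
  by (rule ell2_triangle(1))
lift_definition uminus_ell2 :: "ell2 \<Rightarrow> ell2" is "\<lambda>x i. - x i" by simp
lift_definition minus_ell2 :: "ell2 \<Rightarrow> ell2 \<Rightarrow> ell2" is "\<lambda>x y i. x i - y i"
  using ell2_triangle(1)[of _ "\<lambda>i. - y i" for y] by simp
lift_definition scaleC_ell2 :: "complex \<Rightarrow> ell2 \<Rightarrow> ell2" is "\<lambda>c x i. c * x i"
  by (simp add: norm_mult power_mult_distrib summable_mult)
lift_definition scaleR_ell2 :: "real \<Rightarrow> ell2 \<Rightarrow> ell2" is "\<lambda>r x i. complex_of_real r * x i"
  by (simp add: norm_mult power_mult_distrib summable_mult)
lift_definition norm_ell2 :: "ell2 \<Rightarrow> real" is "\<lambda>x. sqrt (\<Sum>i. (cmod (x i))\<^sup>2)" .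
definition dist_ell2 :: "ell2 \<Rightarrow> ell2 \<Rightarrow> real" where "dist_ell2 x y = norm (x - y)"
definition sgn_ell2 :: "ell2 \<Rightarrow> ell2" where "sgn_ell2 x = inverse (norm x) *\<^sub>R x"
definition uniformity_ell2 :: "(ell2 \<times> ell2) filter" where
  "uniformity_ell2 = (INF e\<in>{0<..}. principal {(x, y). dist x y < e})"
definition open_ell2 :: "ell2 set \<Rightarrow> bool" where
  "open_ell2 U \<longleftrightarrow> (\<forall>x\<in>U. \<forall>\<^sub>F (x', y) in uniformity. x' = x \<longrightarrow> y \<in> U)"

instance
proof
  fix x y z :: ell2 and r s :: real and c d :: complex
  show "x + y + z = x + (y + z)" "x + y = y + x" "0 + x = x" "- x + x = 0" "x - y = x + - y"
    by (transfer; simp add: algebra_simps fun_eq_iff)+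
  show "c *\<^sub>C (x + y) = c *\<^sub>C x + c *\<^sub>C y" "(c + d) *\<^sub>C x = c *\<^sub>C x + d *\<^sub>C x"
    "c *\<^sub>C (d *\<^sub>C x) = (c * d) *\<^sub>C x" "1 *\<^sub>C x = x"
    by (transfer; simp add: algebra_simps fun_eq_iff)+
  show "r *\<^sub>R (x + y) = r *\<^sub>R x + r *\<^sub>R y" "(r + s) *\<^sub>R x = r *\<^sub>R x + s *\<^sub>R x"
    "r *\<^sub>R (s *\<^sub>R x) = (r * s) *\<^sub>R x" "1 *\<^sub>R x = x" "r *\<^sub>R x = complex_of_real r *\<^sub>C x"
    by (transfer; simp add: algebra_simps fun_eq_iff)+
  show "(norm x = 0) = (x = 0)"
    by transfer (simp add: suminf_eq_zero_iff fun_eq_iff)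
  show "norm (x + y) \<le> norm x + norm y"
    by transfer (rule ell2_triangle(2))
  show nC: "norm (c *\<^sub>C x) = cmod c * norm x" for c
    by transfer (simp add: norm_mult power_mult_distrib suminf_mult real_sqrt_mult)
  have "r *\<^sub>R x = complex_of_real r *\<^sub>C x" by (transfer; simp)
  then show "norm (r *\<^sub>R x) = \<bar>r\<bar> * norm x" by (simp add: nC)
qed (simp_all add: dist_ell2_def sgn_ell2_def uniformity_ell2_def open_ell2_def)

end

definition compact_operators :: "(ell2 \<Rightarrow>\<^sub>L ell2) set" where
  "compact_operators =
     {T. clinear_on UNIV (blinfun_apply T) \<and> compact (closure (blinfun_apply T ` cball 0 1))}"


section \<open>Operator spaces\<close>

text \<open>
  An operator space is given by its underlying vector space and the norms on the spaces
  \<open>M\<^sub>n(E)\<close>, to which only the entries \<open>i, j < n\<close> of a matrix \<open>nat \<Rightarrow> nat \<Rightarrow> 'a\<close> contribute.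
  The norms take extended real values only so that suprema need no boundedness side conditions;
  they are finite on all the spaces below.
\<close>

record 'a opspace =
  os_carrier :: "'a set"
  os_norm :: "nat \<Rightarrow> (nat \<Rightarrow> nat \<Rightarrow> 'a) \<Rightarrow> ereal"

text \<open>A subspace of \<open>B(\<ell>\<^sub>2)\<close>, normed by \<open>M\<^sub>n(E) \<subseteq> B(\<ell>\<^sub>2\<^sup>n(\<ell>\<^sub>2))\<close>.\<close>

definition concrete_opspace ::
  "(ell2 \<Rightarrow>\<^sub>L ell2) set \<Rightarrow> (ell2 \<Rightarrow>\<^sub>L ell2) opspace" where
  "concrete_opspace E =
     \<lparr>os_carrier = E,
      os_norm = (\<lambda>n A. SUP x \<in> {x :: nat \<Rightarrow> ell2. L2_set (\<lambda>j. norm (x j)) {..<n} \<le> 1}.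
        ereal (L2_set (\<lambda>i. norm (\<Sum>j<n. blinfun_apply (A i j) (x j))) {..<n}))\<rparr>"

text \<open>A subspace of \<open>M\<^sub>k = B(\<ell>\<^sub>2\<^sup>k)\<close>, normed by \<open>M\<^sub>n(E) \<subseteq> B(\<ell>\<^sub>2\<^sup>n(\<ell>\<^sub>2\<^sup>k))\<close>.\<close>

definition matrix_opspace ::
  "nat \<Rightarrow> (nat \<Rightarrow> nat \<Rightarrow> complex) set \<Rightarrow> (nat \<Rightarrow> nat \<Rightarrow> complex) opspace" where
  "matrix_opspace k E =
     \<lparr>os_carrier = E,
      os_norm = (\<lambda>n A.
        SUP x \<in> {x :: nat \<Rightarrow> nat \<Rightarrow> complex.
                  L2_set (\<lambda>j. L2_set (\<lambda>q. cmod (x j q)) {..<k}) {..<n} \<le> 1}.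
        ereal (L2_set (\<lambda>i. L2_set (\<lambda>p. cmod (\<Sum>j<n. \<Sum>q<k. A i j p q * x j q)) {..<k}) {..<n}))\<rparr>"

definition Mat :: "nat \<Rightarrow> (nat \<Rightarrow> nat \<Rightarrow> complex) opspace" where
  "Mat k = matrix_opspace k {a. \<forall>i j. a i j \<noteq> 0 \<longrightarrow> i < k \<and> j < k}"

definition ell_infty :: "nat \<Rightarrow> (nat \<Rightarrow> nat \<Rightarrow> complex) opspace" where
  "ell_infty n = matrix_opspace n {a. \<forall>i j. a i j \<noteq> 0 \<longrightarrow> i = j \<and> i < n}"

definition cb_norm :: "'a opspace \<Rightarrow> 'b opspace \<Rightarrow> ('a \<Rightarrow> 'b) \<Rightarrow> ereal" where
  "cb_norm E F u =
     (SUP n \<in> {1..}. SUP X \<in> {X. (\<forall>i<n. \<forall>j<n. X i j \<in> os_carrier E) \<and> os_norm E n X \<le> 1}.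
        os_norm F n (\<lambda>i j. u (X i j)))"

text \<open>
  Linear bijections that are not complete isomorphisms contribute \<open>\<infinity>\<close> to the infimum.
\<close>

definition d_cb :: "'a::complex_vector opspace \<Rightarrow> 'b::complex_vector opspace \<Rightarrow> ereal" where
  "d_cb E F =
     (INF u \<in> {u. clinear_on (os_carrier E) u \<and> bij_betw u (os_carrier E) (os_carrier F)}.
        cb_norm E F u * cb_norm F E (inv_into (os_carrier E) u))"

definition d_SK :: "'a::complex_vector opspace \<Rightarrow> ereal" where
  "d_SK E =
     (INF F \<in> {F. csubspace F \<and> closed F \<and> F \<subseteq> compact_operators}. d_cb E (concrete_opspace F))"

text \<open>
  The dual operator space, \<open>M\<^sub>n(E\<^sup>*) = cb(E, M\<^sub>n)\<close>.  Functionals are extended by \<open>0\<close>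
  outside the underlying space of \<open>E\<close>, which makes their representation unique.
\<close>

definition dual_opspace :: "'a::complex_vector opspace \<Rightarrow> ('a \<Rightarrow> complex) opspace" where
  "dual_opspace E =
     \<lparr>os_carrier =
        {\<phi>. clinear_on (os_carrier E) \<phi> \<and> (\<forall>x. x \<notin> os_carrier E \<longrightarrow> \<phi> x = 0) \<and>
            (\<exists>C::real. \<forall>x\<in>os_carrier E. ereal (cmod (\<phi> x)) \<le> ereal C * os_norm E 1 (\<lambda>_ _. x))},
      os_norm = (\<lambda>n \<Phi>. cb_norm E (Mat n) (\<lambda>x i j. if i < n \<and> j < n then \<Phi> i j x else 0))\<rparr>"

definition E1 :: "nat \<Rightarrow> ((nat \<Rightarrow> nat \<Rightarrow> complex) \<Rightarrow> complex) opspace" where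
  "E1 n = dual_opspace (ell_infty n)"

end

theory Submission imports Defs "HOL-Combinatorics.Permutations" begin

text \<open>
  Let \<open>u\<close> be an isomorphism of \<open>E\<^sub>1\<^sup>n\<close> onto a space of compact operators and \<open>a\<^sub>c = u(e\<^sub>c)\<close>. On the
  \<open>n\<close>-regular tree with properly \<open>n\<close>-coloured edges let \<open>z\<^sub>c\<close> be the involution along the edges of
  colour \<open>c\<close>, restricted to a finite ball. The Schur test gives \<open>\<parallel>\<Sum> e\<^sub>c \<otimes> z\<^sub>c\<parallel> \<le> 2\<surd>(n - 1)\<close>, hence
  \<open>\<parallel>\<Sum> a\<^sub>c \<otimes> z\<^sub>c\<parallel> \<le> C = 2\<surd>(n - 1) \<parallel>u\<parallel>\<^sub>c\<^sub>b\<close>.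

  Take a finite \<open>n\<close>-coloured graph of large girth with \<open>N\<close> vertices and permutation matrices \<open>x\<^sub>c\<close>.
  As the \<open>a\<^sub>c\<close> are compact, we may replace them by \<open>k \<times> k\<close> matrices. The moments of
  \<open>X = \<Sum> a\<^sub>c \<otimes> x\<^sub>c\<close> agree with those of the tree up to a high order, so only a small proportion of
  the singular values of \<open>X\<close> exceeds \<open>C + \<epsilon>\<close>. Since \<open>k\<close> is fixed while the girth grows, they are
  removed by a projection \<open>1 \<otimes> e\<close> with \<open>tr e \<ge> (1 - \<delta>) N\<close>, that is \<open>\<parallel>\<Sum> a\<^sub>c \<otimes> x\<^sub>c e\<parallel> \<le> C + \<epsilon>\<close>. On the
  other hand pairing with the \<open>x\<^sub>c\<close> at the maximally entangled vector gives
  \<open>\<parallel>\<Sum> e\<^sub>c \<otimes> x\<^sub>c e\<parallel> \<ge> n tr e / N \<ge> n (1 - \<delta>)\<close>. Hence \<open>n \<le> \<parallel>u\<^sup>-\<^sup>1\<parallel>\<^sub>c\<^sub>b C\<close>.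
\<close>

section \<open>Vectors and matrices over a finite index set\<close>

lemma L2_set_reindex_bij_betw: "bij_betw h S T \<Longrightarrow> L2_set g T = L2_set (\<lambda>v. g (h v)) S"
  unfolding L2_set_def by (subst sum.reindex_bij_betw[symmetric]) auto

lemma power2_le_mult_imp_le:
  fixes x y :: real
  assumes "x\<^sup>2 \<le> y * x" "0 \<le> x" "0 \<le> y"
  shows "x \<le> y"
proof (cases "x = 0")
  case False
  then show ?thesis using assms by (simp add: power2_eq_square)
qed (use assms in simp)

definition cinner_on :: "'a set \<Rightarrow> ('a \<Rightarrow> complex) \<Rightarrow> ('a \<Rightarrow> complex) \<Rightarrow> complex" where
  "cinner_on S f g = (\<Sum>z\<in>S. cnj (f z) * g z)"

definition cnorm_on :: "'a set \<Rightarrow> ('a \<Rightarrow> complex) \<Rightarrow> real" where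
  "cnorm_on S f = L2_set (\<lambda>z. cmod (f z)) S"

lemma cnorm_on_nonneg [simp]: "0 \<le> cnorm_on S f"
  by (simp add: cnorm_on_def)

lemma cnorm_on_power2: "(cnorm_on S f)\<^sup>2 = (\<Sum>z\<in>S. (cmod (f z))\<^sup>2)"
  by (simp add: cnorm_on_def L2_set_def sum_nonneg)

lemma cinner_on_self: "cinner_on S f f = complex_of_real ((cnorm_on S f)\<^sup>2)"
  unfolding cinner_on_def cnorm_on_power2 of_real_sum
  by (intro sum.cong refl) (metis complex_norm_square mult.commute of_real_power)

lemma cmod_cinner_on_self: "cmod (cinner_on S f f) = (cnorm_on S f)\<^sup>2"
  by (simp add: cinner_on_self norm_power)

lemma cnorm_on_cong: "(\<And>z. z \<in> S \<Longrightarrow> f z = g z) \<Longrightarrow> cnorm_on S f = cnorm_on S g"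
  unfolding cnorm_on_def by (intro L2_set_cong) auto

lemma cnorm_on_scale: "cnorm_on S (\<lambda>z. c * f z) = cmod c * cnorm_on S f"
  by (simp add: cnorm_on_def norm_mult L2_set_right_distrib)

lemma cmod_le_cnorm_on: "finite S \<Longrightarrow> z \<in> S \<Longrightarrow> cmod (f z) \<le> cnorm_on S f"
  unfolding cnorm_on_def using member_le_L2_set[of S z "\<lambda>z. cmod (f z)"] by auto

lemma cnj_cinner_on: "cnj (cinner_on S f g) = cinner_on S g f"
  by (simp add: cinner_on_def cnj_sum mult.commute)

lemma cinner_on_diff_right: "cinner_on S f (\<lambda>z. g z - h z) = cinner_on S f g - cinner_on S f h"
  by (simp add: cinner_on_def algebra_simps sum_subtractf)

lemma cinner_on_scale_right: "cinner_on S f (\<lambda>z. c * g z) = c * cinner_on S f g"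
  by (simp add: cinner_on_def sum_distrib_left algebra_simps)

lemma cinner_on_sum_right:
  "cinner_on S f (\<lambda>z. \<Sum>j\<in>J. c j * \<xi> j z) = (\<Sum>j\<in>J. c j * cinner_on S f (\<xi> j))"
  unfolding cinner_on_def sum_distrib_left by (subst sum.swap) (simp add: algebra_simps)

lemma cinner_on_eq_0_commute: "cinner_on S f g = 0 \<longleftrightarrow> cinner_on S g f = 0"
  by (metis cnj_cinner_on complex_cnj_zero)

lemma cmod_cinner_on_le: "cmod (cinner_on S f g) \<le> cnorm_on S f * cnorm_on S g"
proof -
  have "cmod (cinner_on S f g) \<le> (\<Sum>z\<in>S. \<bar>cmod (f z)\<bar> * \<bar>cmod (g z)\<bar>)"
    unfolding cinner_on_def by (rule order_trans[OF norm_sum]) (simp add: norm_mult)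
  also have "\<dots> \<le> cnorm_on S f * cnorm_on S g"
    unfolding cnorm_on_def by (rule L2_set_mult_ineq)
  finally show ?thesis .
qed

definition basis_vec :: "'a \<Rightarrow> 'a \<Rightarrow> complex" where
  "basis_vec w z = of_bool (z = w)"

lemma cinner_on_basis_vec: "finite S \<Longrightarrow> w \<in> S \<Longrightarrow> cinner_on S (basis_vec w) f = f w"
  by (simp add: cinner_on_def basis_vec_def of_bool_def if_distrib[of cnj]
      if_distrib[of "\<lambda>x. x * _"] cong: if_cong)

lemma cnorm_on_eq_1_iff: "cnorm_on S f = 1 \<longleftrightarrow> cinner_on S f f = 1"
  unfolding cinner_on_self of_real_eq_1_iff power2_eq_1_iff by (smt (verit) cnorm_on_nonneg)

lemma cnorm_on_basis_vec: "finite S \<Longrightarrow> w \<in> S \<Longrightarrow> cnorm_on S (basis_vec w) = 1"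
  unfolding cnorm_on_eq_1_iff by (simp add: cinner_on_basis_vec) (simp add: basis_vec_def)

definition orthonormal_on :: "'a set \<Rightarrow> nat \<Rightarrow> (nat \<Rightarrow> 'a \<Rightarrow> complex) \<Rightarrow> bool" where
  "orthonormal_on S r \<xi> \<longleftrightarrow> (\<forall>i<r. \<forall>j<r. cinner_on S (\<xi> i) (\<xi> j) = of_bool (i = j))"

lemma orthonormal_on_cnorm_on: "orthonormal_on S r \<xi> \<Longrightarrow> j < r \<Longrightarrow> cnorm_on S (\<xi> j) = 1"
  by (simp add: orthonormal_on_def cnorm_on_eq_1_iff)

lemma orthonormal_on_extend:
  assumes "orthonormal_on S r \<xi>" "cnorm_on S \<zeta> = 1"
    and "\<And>j. j < r \<Longrightarrow> cinner_on S (\<xi> j) \<zeta> = 0"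
  shows "orthonormal_on S (Suc r) (\<xi>(r := \<zeta>))"
  using assms unfolding orthonormal_on_def cnorm_on_eq_1_iff
  by (auto simp: less_Suc_eq cinner_on_eq_0_commute[of S \<zeta>])

lemma bessel_inequality:
  assumes "orthonormal_on S r \<xi>"
  shows "(\<Sum>j<r. (cmod (cinner_on S (\<xi> j) g))\<^sup>2) \<le> (cnorm_on S g)\<^sup>2"
proof -
  define c where "c j = cinner_on S (\<xi> j) g" for j
  define h where "h = (\<lambda>z. g z - (\<Sum>j<r. c j * \<xi> j z))"
  have residual_orth: "cinner_on S (\<xi> i) h = 0" if "i < r" for i
  proof -
    have "cinner_on S (\<xi> i) h = c i - (\<Sum>j<r. c j * cinner_on S (\<xi> i) (\<xi> j))"
      unfolding h_def cinner_on_diff_right cinner_on_sum_right c_def ..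
    also have "(\<Sum>j<r. c j * cinner_on S (\<xi> i) (\<xi> j)) = (\<Sum>j<r. if j = i then c j else 0)"
      using assms that by (intro sum.cong) (auto simp: orthonormal_on_def)
    finally show ?thesis using that by simp
  qed
  have "cinner_on S h h = cinner_on S h g - (\<Sum>j<r. c j * cinner_on S h (\<xi> j))"
    unfolding cinner_on_diff_right[symmetric] cinner_on_sum_right[symmetric] h_def ..
  also have "(\<Sum>j<r. c j * cinner_on S h (\<xi> j)) = 0"
    using residual_orth by (intro sum.neutral) (simp add: cinner_on_eq_0_commute[of S h])
  also have "cinner_on S h g = cnj (cinner_on S g h)" by (simp add: cnj_cinner_on)
  also have "cinner_on S g h = cinner_on S g g - (\<Sum>j<r. c j * cnj (c j))"
    unfolding h_def cinner_on_diff_right cinner_on_sum_right c_def by (simp add: cnj_cinner_on)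
  finally have "complex_of_real ((cnorm_on S h)\<^sup>2) =
      complex_of_real ((cnorm_on S g)\<^sup>2 - (\<Sum>j<r. (cmod (c j))\<^sup>2))"
    by (simp add: cinner_on_self complex_norm_square[symmetric] cnj_sum mult.commute)
  then have "(cnorm_on S h)\<^sup>2 = (cnorm_on S g)\<^sup>2 - (\<Sum>j<r. (cmod (c j))\<^sup>2)"
    by (simp only: of_real_eq_iff)
  then show ?thesis unfolding c_def by (smt (verit) zero_le_power2)
qed

definition mat_vec :: "'a set \<Rightarrow> ('b \<Rightarrow> 'a \<Rightarrow> complex) \<Rightarrow> ('a \<Rightarrow> complex) \<Rightarrow> 'b \<Rightarrow> complex" where
  "mat_vec S A f v = (\<Sum>w\<in>S. A v w * f w)"

definition mat_mul ::
  "'a set \<Rightarrow> ('b \<Rightarrow> 'a \<Rightarrow> complex) \<Rightarrow> ('a \<Rightarrow> 'c \<Rightarrow> complex) \<Rightarrow> 'b \<Rightarrow> 'c \<Rightarrow> complex" where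
  "mat_mul S A B v w = mat_vec S A (\<lambda>u. B u w) v"

definition conj_transpose :: "('a \<Rightarrow> 'b \<Rightarrow> complex) \<Rightarrow> 'b \<Rightarrow> 'a \<Rightarrow> complex" where
  "conj_transpose A v w = cnj (A w v)"

definition mat_norm_le :: "'a set \<Rightarrow> ('a \<Rightarrow> 'a \<Rightarrow> complex) \<Rightarrow> real \<Rightarrow> bool" where
  "mat_norm_le S A r \<longleftrightarrow> (\<forall>f. cnorm_on S (mat_vec S A f) \<le> r * cnorm_on S f)"

lemma mat_norm_leD: "mat_norm_le S A r \<Longrightarrow> cnorm_on S (mat_vec S A f) \<le> r * cnorm_on S f"
  by (simp add: mat_norm_le_def)

lemma mat_vec_cong: "(\<And>w. w \<in> S \<Longrightarrow> A v w * f w = B v w * g w) \<Longrightarrow> mat_vec S A f v = mat_vec S B g v"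
  by (simp add: mat_vec_def cong: sum.cong)

lemma mat_vec_scale: "mat_vec S A (\<lambda>w. c * f w) = (\<lambda>v. c * mat_vec S A f v)"
  by (simp add: mat_vec_def fun_eq_iff sum_distrib_left mult_ac)

lemma mat_vec_mat_vec: "mat_vec S A (mat_vec S B f) = mat_vec S (mat_mul S A B) f"
  unfolding mat_vec_def mat_mul_def sum_distrib_left sum_distrib_right fun_eq_iff
  by (subst sum.swap) (simp add: mult.assoc)

lemma mat_norm_le_cong:
  assumes "\<And>v w. v \<in> S \<Longrightarrow> w \<in> S \<Longrightarrow> A v w = B v w"
  shows "mat_norm_le S A r \<longleftrightarrow> mat_norm_le S B r"
proof -
  have "cnorm_on S (mat_vec S A f) = cnorm_on S (mat_vec S B f)" for f
    using assms by (intro cnorm_on_cong mat_vec_cong) simp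
  then show ?thesis by (simp add: mat_norm_le_def)
qed

lemma mat_norm_le_divide_iff:
  assumes "0 < t"
  shows "mat_norm_le S (\<lambda>v w. A v w / complex_of_real t) r \<longleftrightarrow> mat_norm_le S A (t * r)"
proof -
  have "mat_vec S (\<lambda>v w. A v w / complex_of_real t) f =
      (\<lambda>v. complex_of_real (1 / t) * mat_vec S A f v)" for f
    by (simp add: mat_vec_def fun_eq_iff sum_divide_distrib)
  then have "cnorm_on S (mat_vec S (\<lambda>v w. A v w / complex_of_real t) f) =
      cnorm_on S (mat_vec S A f) / t" for f
    using assms by (simp only: cnorm_on_scale norm_of_real) simp
  then show ?thesis using assms by (simp add: mat_norm_le_def pos_divide_le_eq mult_ac)
qed

lemma mat_norm_le_mat_mul:
  assumes "mat_norm_le S A r" "mat_norm_le S B t" "0 \<le> r"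
  shows "mat_norm_le S (mat_mul S A B) (r * t)"
  unfolding mat_norm_le_def
proof
  fix f
  have "cnorm_on S (mat_vec S A (mat_vec S B f)) \<le> r * cnorm_on S (mat_vec S B f)"
    by (rule mat_norm_leD[OF assms(1)])
  also have "\<dots> \<le> r * (t * cnorm_on S f)"
    by (intro mult_left_mono mat_norm_leD assms)
  finally show "cnorm_on S (mat_vec S (mat_mul S A B) f) \<le> r * t * cnorm_on S f"
    by (simp add: mat_vec_mat_vec mult.assoc)
qed

lemma mat_norm_le_reindex:
  fixes S :: "'s set" and T :: "'t set"
  assumes bij_h: "bij_betw h S T"
  shows "mat_norm_le S (\<lambda>v w. A (h v) (h w)) r \<longleftrightarrow> mat_norm_le T A r"
proof
  have norm_T: "cnorm_on T f = cnorm_on S (\<lambda>v. f (h v))" for f :: "'t \<Rightarrow> complex"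
    unfolding cnorm_on_def by (rule L2_set_reindex_bij_betw[OF bij_h])
  have apply_T: "mat_vec T A f (h v) = mat_vec S (\<lambda>v w. A (h v) (h w)) (\<lambda>w. f (h w)) v" for f v
    unfolding mat_vec_def by (simp add: sum.reindex_bij_betw[OF bij_h, symmetric])
  show "mat_norm_le T A r" if "mat_norm_le S (\<lambda>v w. A (h v) (h w)) r"
    unfolding mat_norm_le_def norm_T apply_T using mat_norm_leD[OF that] by blast
  show "mat_norm_le S (\<lambda>v w. A (h v) (h w)) r" if "mat_norm_le T A r"
    unfolding mat_norm_le_def
  proof
    fix g :: "'s \<Rightarrow> complex"
    define f where "f w = g (inv_into S h w)" for w
    have "f (h v) = g v" if "v \<in> S" for v
      using bij_betw_inv_into_left[OF bij_h that] by (simp add: f_def)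
    then have "cnorm_on S (\<lambda>v. f (h v)) = cnorm_on S g"
      "mat_vec S (\<lambda>v w. A (h v) (h w)) (\<lambda>w. f (h w)) = mat_vec S (\<lambda>v w. A (h v) (h w)) g"
      by (auto intro!: cnorm_on_cong mat_vec_cong ext)
    then show "cnorm_on S (mat_vec S (\<lambda>v w. A (h v) (h w)) g) \<le> r * cnorm_on S g"
      using mat_norm_leD[OF that, of f] by (simp add: norm_T apply_T)
  qed
qed

lemma cinner_on_mat_vec:
  "cinner_on S (mat_vec S A f) g = cinner_on S f (mat_vec S (conj_transpose A) g)"
  unfolding cinner_on_def mat_vec_def conj_transpose_def cnj_sum sum_distrib_left sum_distrib_right
  by (subst sum.swap) (simp add: mult_ac)

lemma mat_norm_le_conj_transpose:
  assumes "mat_norm_le S A r"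
  shows "mat_norm_le S (conj_transpose A) r"
  unfolding mat_norm_le_def
proof
  fix f
  define g where "g = mat_vec S (conj_transpose A) f"
  have r_f: "0 \<le> r * cnorm_on S f"
    using mat_norm_leD[OF assms, of f] cnorm_on_nonneg order_trans by blast
  have "(cnorm_on S g)\<^sup>2 = cmod (cinner_on S (mat_vec S A g) f)"
    unfolding cmod_cinner_on_self[symmetric] cinner_on_mat_vec g_def ..
  also have "\<dots> \<le> cnorm_on S (mat_vec S A g) * cnorm_on S f" by (rule cmod_cinner_on_le)
  also have "\<dots> \<le> (r * cnorm_on S g) * cnorm_on S f"
    by (intro mult_right_mono mat_norm_leD assms) simp
  finally have "(cnorm_on S g)\<^sup>2 \<le> (r * cnorm_on S f) * cnorm_on S g" by (simp add: mult_ac)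
  then show "cnorm_on S g \<le> r * cnorm_on S f"
    by (rule power2_le_mult_imp_le[OF _ cnorm_on_nonneg r_f])
qed

section \<open>Counting large singular values by moments\<close>

definition gram :: "'a set \<Rightarrow> ('a \<Rightarrow> 'a \<Rightarrow> complex) \<Rightarrow> ('a \<Rightarrow> complex) \<Rightarrow> 'a \<Rightarrow> complex" where
  "gram S A f = mat_vec S (conj_transpose A) (mat_vec S A f)"

lemma cinner_on_gram: "cinner_on S f (gram S A g) = cinner_on S (mat_vec S A f) (mat_vec S A g)"
  by (simp add: gram_def cinner_on_mat_vec)

lemma gram_funpow_selfadjoint:
  "cinner_on S ((gram S A ^^ i) f) g = cinner_on S f ((gram S A ^^ i) g)"
proof (induction i arbitrary: f g)
  case (Suc i)
  have "cinner_on S (gram S A f) g = cinner_on S f (gram S A g)" for f g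
    by (metis cinner_on_gram cnj_cinner_on)
  then show ?case by (simp add: Suc) (simp add: funpow_swap1)
qed simp

lemma cnorm_on_gram_funpow_power2:
  "(cnorm_on S ((gram S A ^^ i) f))\<^sup>2 = cmod (cinner_on S f ((gram S A ^^ (2 * i)) f))"
  unfolding cmod_cinner_on_self[symmetric] gram_funpow_selfadjoint by (simp add: mult_2 funpow_add)

lemma cnorm_on_gram_funpow_le:
  assumes "mat_norm_le S A r" "0 \<le> r"
  shows "cnorm_on S ((gram S A ^^ i) f) \<le> r ^ (2 * i) * cnorm_on S f"
proof (induction i)
  case (Suc i)
  let ?g = "(gram S A ^^ i) f"
  have "cnorm_on S ((gram S A ^^ Suc i) f) \<le> r * cnorm_on S (mat_vec S A ?g)"
    using mat_norm_leD[OF mat_norm_le_conj_transpose[OF assms(1)]] by (simp add: gram_def)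
  also have "\<dots> \<le> r * (r * cnorm_on S ?g)" by (intro mult_left_mono mat_norm_leD assms)
  also have "\<dots> \<le> r * (r * (r ^ (2 * i) * cnorm_on S f))"
    using assms(2) Suc by (intro mult_left_mono) auto
  finally show ?case by (simp add: mult_ac)
qed simp

text \<open>Squaring the exponent repeatedly needs only Cauchy--Schwarz and no spectral theorem.\<close>

lemma cnorm_on_gram_funpow_ge:
  assumes "cnorm_on S \<xi> = 1"
  shows "cnorm_on S (mat_vec S A \<xi>) ^ (2 * 2 ^ i) \<le> cnorm_on S ((gram S A ^^ (2 ^ i)) \<xi>)"
proof (induction i)
  case 0
  have "(cnorm_on S (mat_vec S A \<xi>))\<^sup>2 = cmod (cinner_on S \<xi> (gram S A \<xi>))"
    unfolding cinner_on_gram cmod_cinner_on_self ..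
  also have "\<dots> \<le> cnorm_on S (gram S A \<xi>)"
    using cmod_cinner_on_le[of S \<xi> "gram S A \<xi>"] assms by simp
  finally show ?case by simp
next
  case (Suc i)
  have "cnorm_on S (mat_vec S A \<xi>) ^ (2 * 2 ^ Suc i) = (cnorm_on S (mat_vec S A \<xi>) ^ (2 * 2 ^ i))\<^sup>2"
    by (simp add: power_mult[symmetric] mult_ac)
  also have "\<dots> \<le> (cnorm_on S ((gram S A ^^ (2 ^ i)) \<xi>))\<^sup>2"
    using Suc by (intro power_mono) auto
  also have "\<dots> = cmod (cinner_on S \<xi> ((gram S A ^^ (2 ^ Suc i)) \<xi>))"
    by (simp add: cnorm_on_gram_funpow_power2)
  also have "\<dots> \<le> cnorm_on S ((gram S A ^^ (2 ^ Suc i)) \<xi>)"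
    using cmod_cinner_on_le[of S \<xi>] assms by (metis mult_1)
  finally show ?case .
qed

lemma orthonormal_on_sum_cnorm_le:
  assumes selfadjoint: "\<And>f g. cinner_on S (M f) g = cinner_on S f (M g)" and finite_S: "finite S"
    and orthonormal: "orthonormal_on S r \<xi>"
  shows "(\<Sum>j<r. (cnorm_on S (M (\<xi> j)))\<^sup>2) \<le> (\<Sum>z\<in>S. (cnorm_on S (M (basis_vec z)))\<^sup>2)"
proof -
  have coord: "cmod (M f z) = cmod (cinner_on S f (M (basis_vec z)))" if "z \<in> S" for f z
    by (metis selfadjoint cinner_on_basis_vec[OF finite_S that] cnj_cinner_on complex_mod_cnj)
  have "(\<Sum>j<r. (cnorm_on S (M (\<xi> j)))\<^sup>2) = (\<Sum>z\<in>S. \<Sum>j<r. (cmod (M (\<xi> j) z))\<^sup>2)"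
    unfolding cnorm_on_power2 by (rule sum.swap)
  also have "\<dots> = (\<Sum>z\<in>S. \<Sum>j<r. (cmod (cinner_on S (\<xi> j) (M (basis_vec z))))\<^sup>2)"
    by (intro sum.cong refl) (simp add: coord)
  also have "\<dots> \<le> (\<Sum>z\<in>S. (cnorm_on S (M (basis_vec z)))\<^sup>2)"
    by (intro sum_mono bessel_inequality orthonormal)
  finally show ?thesis .
qed

lemma orthonormal_on_large_count_le:
  assumes finite_S: "finite S" and orthonormal: "orthonormal_on S r \<xi>" and c_nonneg: "0 \<le> c"
    and large: "\<And>j. j < r \<Longrightarrow> c \<le> cnorm_on S (mat_vec S A (\<xi> j))"
    and moment: "\<And>z. z \<in> S \<Longrightarrow> cmod ((gram S A ^^ (2 * 2 ^ i)) (basis_vec z) z) \<le> B"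
  shows "real r * c ^ (4 * 2 ^ i) \<le> real (card S) * B"
proof -
  let ?M = "gram S A ^^ (2 ^ i)"
  have "real r * c ^ (4 * 2 ^ i) = (\<Sum>j<r. (c ^ (2 * 2 ^ i))\<^sup>2)"
    by (simp add: power_mult[symmetric] mult_ac)
  also have "\<dots> \<le> (\<Sum>j<r. (cnorm_on S (?M (\<xi> j)))\<^sup>2)"
    using large c_nonneg orthonormal_on_cnorm_on[OF orthonormal]
    by (intro sum_mono power_mono order_trans[OF _ cnorm_on_gram_funpow_ge]) auto
  also have "\<dots> \<le> (\<Sum>z\<in>S. (cnorm_on S (?M (basis_vec z)))\<^sup>2)"
    by (intro orthonormal_on_sum_cnorm_le gram_funpow_selfadjoint finite_S orthonormal)
  also have "\<dots> \<le> (\<Sum>z\<in>S. B)"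
    using moment
    by (intro sum_mono) (simp add: cnorm_on_gram_funpow_power2 cinner_on_basis_vec finite_S)
  finally show ?thesis by simp
qed

section \<open>Tensor products of matrices\<close>

lemma cinner_on_Times:
  "cinner_on (A \<times> V) f g = (\<Sum>p\<in>A. cinner_on V (\<lambda>v. f (p, v)) (\<lambda>v. g (p, v)))"
  unfolding cinner_on_def by (rule sum.cartesian_product')

lemma cnorm_on_Times_power2:
  "(cnorm_on (A \<times> V) f)\<^sup>2 = (\<Sum>p\<in>A. (cnorm_on V (\<lambda>v. f (p, v)))\<^sup>2)"
  unfolding cnorm_on_power2 by (rule sum.cartesian_product')

lemma cnorm_on_Times_power2_swap:
  "(cnorm_on (A \<times> V) f)\<^sup>2 = (\<Sum>v\<in>V. (cnorm_on A (\<lambda>p. f (p, v)))\<^sup>2)"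
  unfolding cnorm_on_power2 sum.cartesian_product' by (rule sum.swap)

text \<open>\<open>tensor_sum n b x\<close> is the matrix of \<open>\<Sum>\<^sub>c b\<^sub>c \<otimes> x\<^sub>c\<close>, and \<open>amplify V e\<close> the operator \<open>1 \<otimes> e\<close>.\<close>

definition tensor_sum ::
  "nat \<Rightarrow> (nat \<Rightarrow> 'a \<Rightarrow> 'a \<Rightarrow> complex) \<Rightarrow> (nat \<Rightarrow> 'v \<Rightarrow> 'v \<Rightarrow> complex) \<Rightarrow> 'a \<times> 'v \<Rightarrow> 'a \<times> 'v \<Rightarrow> complex"
  where "tensor_sum n b x = (\<lambda>(p, v) (q, w). \<Sum>c<n. b c p q * x c v w)"

definition amplify ::
  "'v set \<Rightarrow> ('v \<Rightarrow> 'v \<Rightarrow> complex) \<Rightarrow> ('a \<times> 'v \<Rightarrow> complex) \<Rightarrow> 'a \<times> 'v \<Rightarrow> complex" where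
  "amplify V e f = (\<lambda>(p, v). mat_vec V e (\<lambda>w. f (p, w)) v)"

lemma mat_vec_tensor_sum:
  "mat_vec (A \<times> V) (tensor_sum n b x) f (p, v) =
    (\<Sum>c<n. \<Sum>q\<in>A. b c p q * mat_vec V (x c) (\<lambda>w. f (q, w)) v)"
proof -
  have "mat_vec (A \<times> V) (tensor_sum n b x) f (p, v) =
      (\<Sum>q\<in>A. \<Sum>w\<in>V. \<Sum>c<n. b c p q * (x c v w * f (q, w)))"
    unfolding mat_vec_def tensor_sum_def sum.cartesian_product'
    by (simp add: sum_distrib_right mult.assoc)
  also have "\<dots> = (\<Sum>q\<in>A. \<Sum>c<n. \<Sum>w\<in>V. b c p q * (x c v w * f (q, w)))"
    by (intro sum.cong refl sum.swap)
  also have "\<dots> = (\<Sum>c<n. \<Sum>q\<in>A. \<Sum>w\<in>V. b c p q * (x c v w * f (q, w)))"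
    by (rule sum.swap)
  finally show ?thesis by (simp add: mat_vec_def[of V] sum_distrib_left)
qed

lemma mat_vec_tensor_sum_swap:
  "mat_vec (A \<times> V) (tensor_sum n b x) f (p, v) =
    (\<Sum>c<n. \<Sum>w\<in>V. x c v w * mat_vec A (b c) (\<lambda>q. f (q, w)) p)"
  unfolding mat_vec_tensor_sum
  by (simp add: mat_vec_def sum_distrib_left sum.swap[of _ A] mult.left_commute)

lemma conj_transpose_tensor_sum:
  "conj_transpose (tensor_sum n b x) =
    tensor_sum n (\<lambda>c. conj_transpose (b c)) (\<lambda>c. conj_transpose (x c))"
  by (auto simp: conj_transpose_def tensor_sum_def fun_eq_iff)

lemma mat_vec_tensor_sum_amplify:
  "mat_vec (A \<times> V) (tensor_sum n b x) (amplify V e f) =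
    mat_vec (A \<times> V) (tensor_sum n b (\<lambda>c. mat_mul V (x c) e)) f"
  by (auto simp: fun_eq_iff mat_vec_tensor_sum amplify_def mat_vec_mat_vec)

lemma tensor_sum_divide:
  "tensor_sum n b (\<lambda>c v w. x c v w / t) = (\<lambda>z z'. tensor_sum n b x z z' / t)"
  by (auto simp: tensor_sum_def fun_eq_iff sum_divide_distrib)

lemma tensor_sum_reindex:
  "tensor_sum n (\<lambda>c i j. z c (h i) (h j)) (\<lambda>c v w. y c (k v) (k w)) =
    (\<lambda>a a'. tensor_sum n z y (map_prod h k a) (map_prod h k a'))"
  by (auto simp: tensor_sum_def fun_eq_iff)

section \<open>Orthogonal projections\<close>

definition hermitian_on :: "'v set \<Rightarrow> ('v \<Rightarrow> 'v \<Rightarrow> complex) \<Rightarrow> bool" where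
  "hermitian_on V e \<longleftrightarrow> (\<forall>v\<in>V. \<forall>w\<in>V. e v w = cnj (e w v))"

definition projection_on :: "'v set \<Rightarrow> ('v \<Rightarrow> 'v \<Rightarrow> complex) \<Rightarrow> bool" where
  "projection_on V e \<longleftrightarrow> hermitian_on V e \<and>
     (\<forall>f. \<forall>v\<in>V. mat_vec V e (mat_vec V e f) v = mat_vec V e f v)"

definition mat_trace :: "'v set \<Rightarrow> ('v \<Rightarrow> 'v \<Rightarrow> complex) \<Rightarrow> complex" where
  "mat_trace V e = (\<Sum>v\<in>V. e v v)"

lemma mat_vec_conj_transpose_hermitian:
  "hermitian_on V e \<Longrightarrow> v \<in> V \<Longrightarrow> mat_vec V (conj_transpose e) f v = mat_vec V e f v"
  by (intro mat_vec_cong) (metis conj_transpose_def hermitian_on_def)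

lemma cinner_on_cong:
  "(\<And>z. z \<in> S \<Longrightarrow> f z = f' z) \<Longrightarrow> (\<And>z. z \<in> S \<Longrightarrow> g z = g' z) \<Longrightarrow>
    cinner_on S f g = cinner_on S f' g'"
  unfolding cinner_on_def by (intro sum.cong) auto

lemma cinner_on_hermitian:
  "hermitian_on V e \<Longrightarrow> cinner_on V (mat_vec V e f) g = cinner_on V f (mat_vec V e g)"
  unfolding cinner_on_mat_vec by (intro cinner_on_cong mat_vec_conj_transpose_hermitian refl)

lemma projection_on_mat_norm_le:
  assumes "projection_on V e"
  shows "mat_norm_le V e 1"
  unfolding mat_norm_le_def
proof
  fix f
  let ?g = "mat_vec V e f"
  have "(cnorm_on V ?g)\<^sup>2 = cmod (cinner_on V f (mat_vec V e ?g))"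
    using assms by (simp add: projection_on_def cinner_on_hermitian flip: cmod_cinner_on_self)
  also have "cinner_on V f (mat_vec V e ?g) = cinner_on V f ?g"
    using assms by (intro cinner_on_cong) (auto simp: projection_on_def)
  also have "cmod \<dots> \<le> cnorm_on V f * cnorm_on V ?g" by (rule cmod_cinner_on_le)
  finally have "cnorm_on V ?g \<le> cnorm_on V f" by (rule power2_le_mult_imp_le) simp_all
  then show "cnorm_on V ?g \<le> 1 * cnorm_on V f" by simp
qed

lemma mat_vec_conj_transpose_tensor_sum:
  assumes "\<And>c. c < n \<Longrightarrow> hermitian_on V (x c)" "v \<in> V"
  shows "mat_vec (A \<times> V) (conj_transpose (tensor_sum n b x)) f (p, v) =
    mat_vec (A \<times> V) (tensor_sum n (\<lambda>c. conj_transpose (b c)) x) f (p, v)"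
  unfolding conj_transpose_tensor_sum mat_vec_tensor_sum
  using assms by (simp add: mat_vec_conj_transpose_hermitian)

lemma cinner_on_amplify:
  "hermitian_on V e \<Longrightarrow>
    cinner_on (A \<times> V) (amplify V e f) g = cinner_on (A \<times> V) f (amplify V e g)"
  by (simp add: cinner_on_Times amplify_def cinner_on_hermitian)

lemma cnorm_on_amplify_le:
  assumes "mat_norm_le V e 1"
  shows "cnorm_on (A \<times> V) (amplify V e f) \<le> cnorm_on (A \<times> V) f"
proof (rule power2_le_imp_le)
  show "(cnorm_on (A \<times> V) (amplify V e f))\<^sup>2 \<le> (cnorm_on (A \<times> V) f)\<^sup>2"
    unfolding cnorm_on_Times_power2 amplify_def prod.case
    using mat_norm_leD[OF assms] by (intro sum_mono power_mono) auto
qed simp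

lemma projection_on_identity:
  assumes "finite V"
  shows "projection_on V basis_vec" "mat_trace V basis_vec = of_nat (card V)"
proof -
  have "mat_vec V basis_vec f v = f v" if "v \<in> V" for f v
    using assms that
    by (simp add: mat_vec_def basis_vec_def of_bool_def if_distrib[of "\<lambda>x. x * _"] cong: if_cong)
  then show "projection_on V basis_vec"
    by (auto simp: projection_on_def hermitian_on_def basis_vec_def)
qed (simp add: mat_trace_def basis_vec_def)

definition remove_vector :: "'v set \<Rightarrow> ('v \<Rightarrow> 'v \<Rightarrow> complex) \<Rightarrow> ('v \<Rightarrow> complex) \<Rightarrow> 'v \<Rightarrow> 'v \<Rightarrow> complex"
  where "remove_vector V e h v w = e v w - h v * cnj (h w) / cinner_on V h h"

lemma mat_vec_remove_vector:
  "mat_vec V (remove_vector V e h) f =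
    (\<lambda>v. mat_vec V e f v - cinner_on V h f / cinner_on V h h * h v)"
  by (simp add: mat_vec_def remove_vector_def cinner_on_def[of V h f] algebra_simps sum_subtractf
      sum_distrib_left sum_divide_distrib fun_eq_iff)

lemma cinner_on_self_eq_0D: "finite V \<Longrightarrow> cinner_on V h h = 0 \<Longrightarrow> v \<in> V \<Longrightarrow> h v = 0"
  using cmod_le_cnorm_on[of V v h] by (simp add: cinner_on_self)

lemma mat_vec_remove_vector_self:
  assumes "finite V" "\<And>v. v \<in> V \<Longrightarrow> mat_vec V e \<eta> v = h v" "cinner_on V h \<eta> = cinner_on V h h" "v \<in> V"
  shows "mat_vec V (remove_vector V e h) \<eta> v = 0"
  using assms cinner_on_self_eq_0D[OF assms(1), of h v]
  by (cases "cinner_on V h h = 0") (auto simp: mat_vec_remove_vector)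

lemma cinner_on_remove_vector:
  assumes "finite V" "\<And>g. cinner_on V h (mat_vec V e g) = cinner_on V h g"
  shows "cinner_on V h (mat_vec V (remove_vector V e h) f) = 0"
proof (cases "cinner_on V h h = 0")
  case True
  then show ?thesis
    using cinner_on_self_eq_0D[OF assms(1) True]
    by (simp add: cinner_on_def[of V h "mat_vec _ _ _"])
next
  case False
  then show ?thesis
    unfolding mat_vec_remove_vector cinner_on_diff_right cinner_on_scale_right assms(2) by simp
qed

lemma mat_trace_remove_vector_ge:
  "Re (mat_trace V e) - 1 \<le> Re (mat_trace V (remove_vector V e h))"
proof -
  have "mat_trace V (remove_vector V e h) = mat_trace V e - cinner_on V h h / cinner_on V h h"
    by (simp add: mat_trace_def remove_vector_def sum_subtractf sum_divide_distrib[symmetric]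
        cinner_on_def mult.commute)
  then show ?thesis by (cases "cinner_on V h h = 0") auto
qed

lemma hermitian_on_remove_vector:
  assumes "hermitian_on V e"
  shows "hermitian_on V (remove_vector V e h)"
  unfolding hermitian_on_def
proof (intro ballI)
  fix v w assume "v \<in> V" "w \<in> V"
  then have "e v w = cnj (e w v)" using assms unfolding hermitian_on_def by blast
  then show "remove_vector V e h v w = cnj (remove_vector V e h w v)"
    by (simp add: remove_vector_def cinner_on_self mult.commute)
qed

text \<open>If \<open>e \<eta> = 0\<close> then the convention \<open>x / 0 = 0\<close> makes \<open>remove_vector V e (e \<eta>)\<close> equal to \<open>e\<close>.\<close>

lemma projection_on_annihilate:
  assumes finite_V: "finite V" and projection_e: "projection_on V e"
  obtains d where "projection_on V d" "\<And>v. v \<in> V \<Longrightarrow> mat_vec V d \<eta> v = 0"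
    "\<And>f v. (\<And>w. w \<in> V \<Longrightarrow> mat_vec V e f w = 0) \<Longrightarrow> v \<in> V \<Longrightarrow> mat_vec V d f v = 0"
    "Re (mat_trace V e) - 1 \<le> Re (mat_trace V d)"
proof -
  have herm: "hermitian_on V e"
    and idem: "\<And>f v. v \<in> V \<Longrightarrow> mat_vec V e (mat_vec V e f) v = mat_vec V e f v"
    using projection_e by (auto simp: projection_on_def)
  define h where "h = mat_vec V e \<eta>"
  define d where "d = remove_vector V e h"
  note d_apply = mat_vec_remove_vector[of V e h, folded d_def]
  have e_h: "mat_vec V e h v = h v" if "v \<in> V" for v using idem[OF that] by (simp add: h_def)
  have h_e: "cinner_on V h (mat_vec V e f) = cinner_on V h f" for f
    unfolding cinner_on_hermitian[OF herm, symmetric] by (intro cinner_on_cong e_h refl)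
  have h_d: "cinner_on V h (mat_vec V d f) = 0" for f
    unfolding d_def by (intro cinner_on_remove_vector finite_V h_e)
  have "mat_vec V d (mat_vec V d f) v = mat_vec V d f v" if v_in: "v \<in> V" for f v
  proof -
    have "mat_vec V d (mat_vec V d f) v = mat_vec V e (mat_vec V d f) v"
      by (simp add: d_apply[of "mat_vec V d f"] h_d)
    also have "\<dots> =
        mat_vec V e (mat_vec V e f) v - cinner_on V h f / cinner_on V h h * mat_vec V e h v"
      by (simp add: d_apply mat_vec_def right_diff_distrib sum_subtractf sum_distrib_left
          sum_divide_distrib mult_ac)
    finally show ?thesis using v_in by (simp add: idem e_h d_apply)
  qed
  then have "projection_on V d"
    using herm by (simp add: projection_on_def d_def hermitian_on_remove_vector)
  moreover have "mat_vec V d \<eta> v = 0" if "v \<in> V" for v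
    unfolding d_def using finite_V h_e[of \<eta>] that
    by (intro mat_vec_remove_vector_self) (simp_all add: h_def)
  moreover have "mat_vec V d f v = 0" if "\<And>w. w \<in> V \<Longrightarrow> mat_vec V e f w = 0" "v \<in> V" for f v
  proof -
    have "cinner_on V h f = 0"
      unfolding h_e[of f, symmetric] using that by (simp add: cinner_on_def)
    then show ?thesis using that by (simp add: d_apply)
  qed
  moreover have "Re (mat_trace V e) - 1 \<le> Re (mat_trace V d)"
    unfolding d_def by (rule mat_trace_remove_vector_ge)
  ultimately show ?thesis using that by blast
qed

lemma projection_on_annihilate_family:
  assumes finite_V: "finite V" and finite_J: "finite J"
  obtains e where "projection_on V e" "\<And>j v. j \<in> J \<Longrightarrow> v \<in> V \<Longrightarrow> mat_vec V e (\<eta> j) v = 0"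
    "real (card V) - real (card J) \<le> Re (mat_trace V e)"
proof -
  from finite_J have "\<exists>e. projection_on V e \<and> (\<forall>j\<in>J. \<forall>v\<in>V. mat_vec V e (\<eta> j) v = 0) \<and>
    real (card V) - real (card J) \<le> Re (mat_trace V e)"
  proof induction
    case empty
    show ?case using projection_on_identity[OF finite_V] by auto
  next
    case (insert i J)
    then obtain e where projection_e: "projection_on V e"
      and e_annihilates: "\<And>j v. j \<in> J \<Longrightarrow> v \<in> V \<Longrightarrow> mat_vec V e (\<eta> j) v = 0"
      and trace_e: "real (card V) - real (card J) \<le> Re (mat_trace V e)" by blast
    obtain d where projection_d: "projection_on V d"
      and d_annihilates: "\<And>v. v \<in> V \<Longrightarrow> mat_vec V d (\<eta> i) v = 0"
      and d_below_e: "\<And>f v. (\<And>w. w \<in> V \<Longrightarrow> mat_vec V e f w = 0) \<Longrightarrow> v \<in> V \<Longrightarrow> mat_vec V d f v = 0"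
      and trace_d: "Re (mat_trace V e) - 1 \<le> Re (mat_trace V d)"
      using projection_on_annihilate[OF finite_V projection_e, of "\<eta> i"] by blast
    have "mat_vec V d (\<eta> j) v = 0" if "j \<in> insert i J" "v \<in> V" for j v
      using that d_annihilates d_below_e[OF e_annihilates] by blast
    moreover have "real (card V) - real (card (insert i J)) \<le> Re (mat_trace V d)"
      using insert trace_e trace_d by simp
    ultimately show ?case using projection_d by blast
  qed
  then show ?thesis using that by blast
qed

lemma unit_vector_expanded:
  assumes finite_S: "finite S" and c_nonneg: "0 \<le> c"
    and expanded: "c * cnorm_on S g < cnorm_on S (mat_vec S X g)"
  obtains t where "cnorm_on S (\<lambda>z. t * g z) = 1" "c < cnorm_on S (mat_vec S X (\<lambda>z. t * g z))"
proof -
  have pos: "0 < cnorm_on S g"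
  proof (rule ccontr)
    assume "\<not> 0 < cnorm_on S g"
    then have zero: "cnorm_on S g = 0" using cnorm_on_nonneg[of S g] by linarith
    then have "g z = 0" if "z \<in> S" for z using cmod_le_cnorm_on[OF finite_S that, of g] by simp
    then have "mat_vec S X g = (\<lambda>_. 0)" by (auto simp: mat_vec_def)
    with zero expanded show False by (simp add: cnorm_on_def L2_set_def)
  qed
  define t where "t = complex_of_real (1 / cnorm_on S g)"
  have cmod_t: "cmod t = 1 / cnorm_on S g" using pos by (simp add: t_def norm_divide)
  show ?thesis
  proof (rule that[of t])
    show "cnorm_on S (\<lambda>z. t * g z) = 1" unfolding cnorm_on_scale cmod_t using pos by simp
    show "c < cnorm_on S (mat_vec S X (\<lambda>z. t * g z))"
      unfolding mat_vec_scale cnorm_on_scale cmod_t using expanded pos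
      by (simp add: pos_less_divide_eq)
  qed
qed

lemma maximal_orthonormal_large_family:
  assumes count: "\<And>r \<xi>. orthonormal_on S r \<xi> \<Longrightarrow>
      (\<And>j. j < r \<Longrightarrow> c < cnorm_on S (mat_vec S X (\<xi> j))) \<Longrightarrow> real r \<le> B"
  obtains r \<xi> where "real r \<le> B"
    "\<And>\<zeta>. cnorm_on S \<zeta> = 1 \<Longrightarrow> (\<And>j. j < r \<Longrightarrow> cinner_on S (\<xi> j) \<zeta> = 0) \<Longrightarrow>
      cnorm_on S (mat_vec S X \<zeta>) \<le> c"
proof -
  define large where
    "large r \<xi> \<longleftrightarrow> orthonormal_on S r \<xi> \<and> (\<forall>j<r. c < cnorm_on S (mat_vec S X (\<xi> j)))" for r \<xi>
  have large_le: "real r \<le> B" if "large r \<xi>" for r \<xi>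
    using that count unfolding large_def by blast
  have "\<exists>r. (\<exists>\<xi>. large r \<xi>) \<and> (\<forall>r'. (\<exists>\<xi>. large r' \<xi>) \<longrightarrow> r' \<le> r)"
  proof (rule Nat.ex_has_greatest_nat)
    show "\<exists>\<xi>. large 0 \<xi>" by (simp add: large_def orthonormal_on_def)
    show "\<forall>r. (\<exists>\<xi>. large r \<xi>) \<longrightarrow> r \<le> nat \<lceil>B\<rceil>"
    proof (intro allI impI)
      fix r assume "\<exists>\<xi>. large r \<xi>"
      then have "real r \<le> B" using large_le by blast
      then show "r \<le> nat \<lceil>B\<rceil>" by linarith
    qed
  qed
  then obtain r \<xi> where large_family: "large r \<xi>"
    and maximal: "\<And>r' \<xi>'. large r' \<xi>' \<Longrightarrow> r' \<le> r" by blast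
  have "cnorm_on S (mat_vec S X \<zeta>) \<le> c"
    if unit: "cnorm_on S \<zeta> = 1" and orth: "\<And>j. j < r \<Longrightarrow> cinner_on S (\<xi> j) \<zeta> = 0" for \<zeta>
  proof (rule ccontr)
    assume "\<not> cnorm_on S (mat_vec S X \<zeta>) \<le> c"
    then have "large (Suc r) (\<xi>(r := \<zeta>))"
      using large_family orth unfolding large_def
      by (auto simp: less_Suc_eq intro!: orthonormal_on_extend[OF _ unit])
    then show False using maximal by fastforce
  qed
  then show ?thesis using that large_le[OF large_family] by blast
qed

text \<open>
  The finite dimension of the first tensor factor enters here: a vector of \<open>\<complex>\<^sup>A \<otimes> \<complex>\<^sup>V\<close> lies in
  \<open>\<complex>\<^sup>A \<otimes> W\<close> with \<open>dim W \<le> |A|\<close>, so removing a maximal orthonormal family of directions on which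
  \<open>X\<close> is large costs at most \<open>|A|\<close> dimensions of \<open>\<complex>\<^sup>V\<close> for each of them.
\<close>

lemma projection_on_cutting_large_directions:
  fixes A :: "'a set" and V :: "'v set" and X :: "'a \<times> 'v \<Rightarrow> 'a \<times> 'v \<Rightarrow> complex"
  assumes finite_A: "finite A" and finite_V: "finite V" and c_nonneg: "0 \<le> c"
    and count: "\<And>r \<xi>. orthonormal_on (A \<times> V) r \<xi> \<Longrightarrow>
      (\<And>j. j < r \<Longrightarrow> c < cnorm_on (A \<times> V) (mat_vec (A \<times> V) X (\<xi> j))) \<Longrightarrow> real r \<le> B"
  obtains e where "projection_on V e" "real (card V) - real (card A) * B \<le> Re (mat_trace V e)"
    "\<And>f. cnorm_on (A \<times> V) (mat_vec (A \<times> V) X (amplify V e f)) \<le> c * cnorm_on (A \<times> V) f"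
proof -
  let ?S = "A \<times> V"
  obtain r \<xi> where r_le: "real r \<le> B" and maximal: "\<And>\<zeta>. cnorm_on ?S \<zeta> = 1 \<Longrightarrow>
      (\<And>j. j < r \<Longrightarrow> cinner_on ?S (\<xi> j) \<zeta> = 0) \<Longrightarrow> cnorm_on ?S (mat_vec ?S X \<zeta>) \<le> c"
    by (rule maximal_orthonormal_large_family[OF count]) blast+
  have "finite ({..<r} \<times> A)" using finite_A by simp
  then obtain e where projection_e: "projection_on V e"
    and e_annihilates: "\<And>z v. z \<in> {..<r} \<times> A \<Longrightarrow> v \<in> V \<Longrightarrow> mat_vec V e (\<lambda>w. \<xi> (fst z) (snd z, w)) v = 0"
    and trace_e: "real (card V) - real (card ({..<r} \<times> A)) \<le> Re (mat_trace V e)"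
    using projection_on_annihilate_family[OF finite_V, where \<eta> = "\<lambda>z w. \<xi> (fst z) (snd z, w)"]
    by blast
  have orth: "cinner_on ?S (\<xi> j) (\<lambda>z. t * amplify V e f z) = 0" if "j < r" for j t f
  proof -
    have "amplify V e (\<xi> j) z = 0" if "z \<in> ?S" for z
      using e_annihilates[of "(j, fst z)" "snd z"] that \<open>j < r\<close> by (auto simp: amplify_def)
    then have "cinner_on ?S (amplify V e (\<xi> j)) f = 0" by (simp add: cinner_on_def)
    then show ?thesis
      using projection_e by (simp add: cinner_on_scale_right projection_on_def cinner_on_amplify)
  qed
  have "cnorm_on ?S (mat_vec ?S X (amplify V e f)) \<le> c * cnorm_on ?S f" for f
  proof -
    have "cnorm_on ?S (mat_vec ?S X (amplify V e f)) \<le> c * cnorm_on ?S (amplify V e f)"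
    proof (rule ccontr)
      assume "\<not> cnorm_on ?S (mat_vec ?S X (amplify V e f)) \<le> c * cnorm_on ?S (amplify V e f)"
      then obtain t where "cnorm_on ?S (\<lambda>z. t * amplify V e f z) = 1"
        "c < cnorm_on ?S (mat_vec ?S X (\<lambda>z. t * amplify V e f z))"
        using unit_vector_expanded[of ?S c "amplify V e f" X] finite_A finite_V c_nonneg by auto
      then show False using maximal orth by fastforce
    qed
    also have "\<dots> \<le> c * cnorm_on ?S f"
      by (intro mult_left_mono cnorm_on_amplify_le projection_on_mat_norm_le projection_e c_nonneg)
    finally show ?thesis .
  qed
  moreover have "real (card V) - real (card A) * B \<le> Re (mat_trace V e)"
    using trace_e mult_left_mono[OF r_le, of "real (card A)"]
    by (simp add: card_cartesian_product mult.commute)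
  ultimately show ?thesis using that projection_e by blast
qed

section \<open>Finite graphs that are locally trees\<close>

definition fun_matrix :: "('v \<Rightarrow> 'v) \<Rightarrow> 'v \<Rightarrow> 'v \<Rightarrow> complex" where
  "fun_matrix g v w = of_bool (w = g v)"

lemma mat_vec_fun_matrix:
  "finite V \<Longrightarrow> mat_vec V (fun_matrix g) f v = (if g v \<in> V then f (g v) else 0)"
  by (simp add: mat_vec_def fun_matrix_def of_bool_def if_distrib[of "\<lambda>x. x * _"] cong: if_cong)

lemma hermitian_on_fun_matrix: "(\<And>v. v \<in> V \<Longrightarrow> g (g v) = v) \<Longrightarrow> hermitian_on V (fun_matrix g)"
  by (auto simp: hermitian_on_def fun_matrix_def)

lemma mat_norm_le_fun_matrix:
  assumes "finite V" "bij_betw g V V"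
  shows "mat_norm_le V (fun_matrix g) 1"
  unfolding mat_norm_le_def
proof
  fix f
  have "cnorm_on V (mat_vec V (fun_matrix g) f) = cnorm_on V (\<lambda>v. f (g v))"
    using assms by (intro cnorm_on_cong) (auto simp: mat_vec_fun_matrix bij_betw_def)
  also have "\<dots> = cnorm_on V f"
    unfolding cnorm_on_def by (rule L2_set_reindex_bij_betw[OF assms(2), symmetric])
  finally show "cnorm_on V (mat_vec V (fun_matrix g) f) \<le> 1 * cnorm_on V f" by simp
qed

text \<open>
  The reduced words of length at most \<open>R\<close> in \<open>n\<close> involutions are the ball of radius \<open>R\<close> around the
  root \<open>[]\<close> of the \<open>n\<close>-regular tree; \<open>flip c\<close> moves along the edge of colour \<open>c\<close>.
\<close>

definition red_words :: "nat \<Rightarrow> nat \<Rightarrow> nat list set" where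
  "red_words n R = {s. set s \<subseteq> {..<n} \<and> distinct_adj s \<and> length s \<le> R}"

definition flip :: "nat \<Rightarrow> nat list \<Rightarrow> nat list" where
  "flip c s = (if s \<noteq> [] \<and> hd s = c then tl s else c # s)"

lemma finite_red_words: "finite (red_words n R)"
  by (rule finite_subset[OF _ finite_lists_length_le[of "{..<n}" R]]) (auto simp: red_words_def)

lemma Nil_in_red_words: "[] \<in> red_words n R"
  by (simp add: red_words_def)

lemma flip_flip: "distinct_adj s \<Longrightarrow> flip c (flip c s) = s"
  by (cases s) (auto simp: flip_def distinct_adj_Cons)

lemma flip_in_red_words:
  "s \<in> red_words n R \<Longrightarrow> c < n \<Longrightarrow> length s < R \<Longrightarrow> flip c s \<in> red_words n R"
  by (cases s) (auto simp: red_words_def flip_def distinct_adj_Cons)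

lemma length_flip_le: "length (flip c s) \<le> Suc (length s)"
  by (auto simp: flip_def)

lemma hermitian_on_flip: "hermitian_on (red_words n R) (fun_matrix (flip c))"
  by (rule hermitian_on_fun_matrix) (simp add: flip_flip red_words_def)

text \<open>
  The finite graph has the permutations of the ball as its vertices; the edge of colour \<open>c\<close> at \<open>v\<close>
  leads to \<open>step n R c \<circ> v\<close>. Distinct reduced words of length at most \<open>R\<close> lead from \<open>v\<close> to distinct
  vertices, since \<open>word_perm n R s\<close> maps \<open>[]\<close> to \<open>s\<close>.
\<close>

definition step :: "nat \<Rightarrow> nat \<Rightarrow> nat \<Rightarrow> nat list \<Rightarrow> nat list" where
  "step n R c s = (if s \<in> red_words n R \<and> flip c s \<in> red_words n R then flip c s else s)"

fun word_perm :: "nat \<Rightarrow> nat \<Rightarrow> nat list \<Rightarrow> nat list \<Rightarrow> nat list" where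
  "word_perm n R [] = id"
| "word_perm n R (c # s) = step n R c \<circ> word_perm n R s"

definition ball_perms :: "nat \<Rightarrow> nat \<Rightarrow> (nat list \<Rightarrow> nat list) set" where
  "ball_perms n R = {v. v permutes red_words n R}"

definition perm_edge :: "nat \<Rightarrow> nat \<Rightarrow> nat \<Rightarrow> (nat list \<Rightarrow> nat list) \<Rightarrow> nat list \<Rightarrow> nat list" where
  "perm_edge n R c v = step n R c \<circ> v"

lemma finite_ball_perms: "finite (ball_perms n R)"
  unfolding ball_perms_def by (rule finite_permutations[OF finite_red_words])

lemma card_ball_perms_pos: "0 < card (ball_perms n R)"
proof -
  have "id \<in> ball_perms n R" by (simp add: ball_perms_def permutes_id)
  then show ?thesis using finite_ball_perms card_gt_0_iff by blast
qed

lemma step_step: "step n R c (step n R c s) = s"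
  by (auto simp: step_def red_words_def flip_flip)

lemma step_permutes: "step n R c permutes red_words n R"
proof (rule bij_imp_permutes)
  show "bij_betw (step n R c) (red_words n R) (red_words n R)"
    by (rule bij_betw_byWitness[where f' = "step n R c"])
      (auto simp: step_step, auto simp: step_def)
qed (simp add: step_def)

lemma perm_edge_in_ball_perms: "v \<in> ball_perms n R \<Longrightarrow> perm_edge n R c v \<in> ball_perms n R"
  by (simp add: ball_perms_def perm_edge_def permutes_compose step_permutes)

lemma perm_edge_perm_edge: "perm_edge n R c (perm_edge n R c v) = v"
  by (simp add: perm_edge_def fun_eq_iff step_step)

lemma bij_betw_perm_edge: "bij_betw (perm_edge n R c) (ball_perms n R) (ball_perms n R)"
  by (rule bij_betw_byWitness[where f' = "perm_edge n R c"])
    (auto simp: perm_edge_perm_edge perm_edge_in_ball_perms)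

lemma hermitian_on_perm_edge: "hermitian_on (ball_perms n R) (fun_matrix (perm_edge n R c))"
  by (rule hermitian_on_fun_matrix) (rule perm_edge_perm_edge)

lemma word_perm_permutes: "word_perm n R s permutes red_words n R"
  by (induction s)
    (auto intro: permutes_compose step_permutes permutes_id simp del: o_apply id_apply)

lemma word_perm_in_ball_perms: "v \<in> ball_perms n R \<Longrightarrow> word_perm n R s \<circ> v \<in> ball_perms n R"
  by (simp add: ball_perms_def permutes_compose word_perm_permutes)

lemma word_perm_Nil: "s \<in> red_words n R \<Longrightarrow> word_perm n R s [] = s"
proof (induction s)
  case (Cons c s)
  then have "s \<in> red_words n R" "flip c s = c # s"
    by (auto simp: red_words_def distinct_adj_Cons flip_def)
  with Cons show ?case by (simp add: step_def)
qed simp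

lemma word_perm_comp_eq_self_iff:
  assumes "v \<in> ball_perms n R" "s \<in> red_words n R"
  shows "word_perm n R s \<circ> v = v \<longleftrightarrow> s = []"
proof
  assume fixes_v: "word_perm n R s \<circ> v = v"
  have "surj v" using assms(1) permutes_surj by (auto simp: ball_perms_def)
  then obtain x where "v x = []" by (metis surjD)
  then show "s = []" using word_perm_Nil[OF assms(2)] fun_cong[OF fixes_v, of x] by simp
qed simp

lemma word_perm_flip:
  assumes "s \<in> red_words n R" "flip c s \<in> red_words n R"
  shows "word_perm n R (flip c s) \<circ> v = perm_edge n R c (word_perm n R s \<circ> v)"
  by (cases s) (auto simp: flip_def fun_eq_iff perm_edge_def step_step)

abbreviation tree_sum ::
  "nat \<Rightarrow> (nat \<Rightarrow> 'a \<Rightarrow> 'a \<Rightarrow> complex) \<Rightarrow> 'a \<times> nat list \<Rightarrow> 'a \<times> nat list \<Rightarrow> complex" where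
  "tree_sum n b \<equiv> tensor_sum n b (\<lambda>c. fun_matrix (flip c))"

abbreviation perm_sum ::
  "nat \<Rightarrow> nat \<Rightarrow> (nat \<Rightarrow> 'a \<Rightarrow> 'a \<Rightarrow> complex) \<Rightarrow>
    'a \<times> (nat list \<Rightarrow> nat list) \<Rightarrow> 'a \<times> (nat list \<Rightarrow> nat list) \<Rightarrow> complex" where
  "perm_sum n R b \<equiv> tensor_sum n b (\<lambda>c. fun_matrix (perm_edge n R c))"

lemma mat_vec_perm_sum_pullback:
  assumes v_in: "v \<in> ball_perms n R" and s_in: "s \<in> red_words n R" and s_short: "length s < R"
    and agree: "\<And>q t. t \<in> red_words n R \<Longrightarrow> length t \<le> Suc (length s) \<Longrightarrow>
      F (q, word_perm n R t \<circ> v) = g (q, t)"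
  shows "mat_vec (A \<times> ball_perms n R) (perm_sum n R b) F
      (p, word_perm n R s \<circ> v) =
    mat_vec (A \<times> red_words n R) (tree_sum n b) g (p, s)"
  unfolding mat_vec_tensor_sum
proof (intro sum.cong refl)
  fix c q assume "c \<in> {..<n}"
  then have flip_in: "flip c s \<in> red_words n R" using s_in s_short by (simp add: flip_in_red_words)
  have "mat_vec (ball_perms n R) (fun_matrix (perm_edge n R c)) (\<lambda>w. F (q, w))
        (word_perm n R s \<circ> v) =
      F (q, word_perm n R (flip c s) \<circ> v)"
    using v_in by (simp add: mat_vec_fun_matrix finite_ball_perms perm_edge_in_ball_perms
        word_perm_in_ball_perms word_perm_flip[OF s_in flip_in])
  also have "\<dots> = mat_vec (red_words n R) (fun_matrix (flip c)) (\<lambda>w. g (q, w)) s"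
    using agree[OF flip_in length_flip_le] flip_in
    by (simp add: mat_vec_fun_matrix finite_red_words)
  finally show "b c p q * mat_vec (ball_perms n R) (fun_matrix (perm_edge n R c)) (\<lambda>w. F (q, w))
        (word_perm n R s \<circ> v) =
      b c p q * mat_vec (red_words n R) (fun_matrix (flip c)) (\<lambda>w. g (q, w)) s"
    by simp
qed

lemma gram_perm_sum_pullback:
  assumes v_in: "v \<in> ball_perms n R" and s_in: "s \<in> red_words n R" and s_short: "Suc (length s) < R"
    and agree: "\<And>q t. t \<in> red_words n R \<Longrightarrow> length t \<le> Suc (Suc (length s)) \<Longrightarrow>
      F (q, word_perm n R t \<circ> v) = g (q, t)"
  shows "gram (A \<times> ball_perms n R) (perm_sum n R b) F (p, word_perm n R s \<circ> v) =
    gram (A \<times> red_words n R) (tree_sum n b) g (p, s)"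
  unfolding gram_def
    mat_vec_conj_transpose_tensor_sum[OF hermitian_on_perm_edge word_perm_in_ball_perms[OF v_in]]
    mat_vec_conj_transpose_tensor_sum[OF hermitian_on_flip s_in]
  using s_in s_short by (intro mat_vec_perm_sum_pullback v_in agree) auto

lemma gram_perm_sum_funpow_pullback:
  assumes v_in: "v \<in> ball_perms n R"
  shows "s \<in> red_words n R \<Longrightarrow> length s + 2 * i \<le> R \<Longrightarrow>
    (gram (A \<times> ball_perms n R) (perm_sum n R b) ^^ i)
      (basis_vec (j, v)) (p, word_perm n R s \<circ> v) =
    (gram (A \<times> red_words n R) (tree_sum n b) ^^ i) (basis_vec (j, [])) (p, s)"
proof (induction i arbitrary: s p)
  case 0
  then show ?case by (simp add: basis_vec_def word_perm_comp_eq_self_iff[OF v_in] del: o_apply)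
next
  case (Suc i)
  then show ?case
    unfolding funpow.simps comp_apply[of _ "_ ^^ i"]
    by (intro gram_perm_sum_pullback v_in Suc.IH) auto
qed

lemma gram_perm_sum_moment_le:
  assumes finite_A: "finite A" and C_nonneg: "0 \<le> C"
    and tree_le: "mat_norm_le (A \<times> red_words n R) (tree_sum n b) C"
    and i_le: "2 * i \<le> R" and z_in: "z \<in> A \<times> ball_perms n R"
  shows "cmod ((gram (A \<times> ball_perms n R) (perm_sum n R b) ^^ i) (basis_vec z) z) \<le> C ^ (2 * i)"
proof -
  let ?S = "A \<times> red_words n R"
  obtain j v where z_def: "z = (j, v)" and j_in: "j \<in> A"
    and v_in: "v \<in> ball_perms n R" using z_in by auto
  have root_in: "(j, []) \<in> ?S" and finite_ball: "finite ?S"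
    using j_in finite_A Nil_in_red_words finite_red_words by auto
  define g where "g = (gram ?S (tree_sum n b) ^^ i) (basis_vec (j, []))"
  have "(gram (A \<times> ball_perms n R) (perm_sum n R b) ^^ i)
      (basis_vec z) z = g (j, [])"
    using gram_perm_sum_funpow_pullback[OF v_in Nil_in_red_words, of i A b j j] i_le
    by (simp add: g_def z_def)
  also have "cmod \<dots> \<le> cnorm_on ?S g" by (rule cmod_le_cnorm_on[OF finite_ball root_in])
  also have "\<dots> \<le> C ^ (2 * i)"
    using cnorm_on_gram_funpow_le[OF tree_le C_nonneg, of i "basis_vec (j, [])"]
      cnorm_on_basis_vec[OF finite_ball root_in]
    by (simp add: g_def)
  finally show ?thesis .
qed

text \<open>
  The diagonal entries of a power of \<open>X\<^sup>*X\<close> only see a ball of the graph, where it is a tree; so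
  \<open>C\<close> bounds all these moments, and few singular values of \<open>X\<close> exceed \<open>c > C\<close>.
\<close>

lemma projection_cutting_graph:
  assumes finite_A: "finite A" and C_nonneg: "0 \<le> C"
    and tree_le: "mat_norm_le (A \<times> red_words n R) (tree_sum n b) C"
    and c_pos: "0 < c" and radius: "4 * 2 ^ i \<le> R"
    and \<delta>_ge: "(real (card A))\<^sup>2 * (C / c) ^ (4 * 2 ^ i) \<le> \<delta>"
  obtains e where "projection_on (ball_perms n R) e"
    "real (card (ball_perms n R)) * (1 - \<delta>) \<le> Re (mat_trace (ball_perms n R) e)"
    "mat_norm_le (A \<times> ball_perms n R)
      (tensor_sum n b (\<lambda>c. mat_mul (ball_perms n R) (fun_matrix (perm_edge n R c)) e)) c"
proof -
  let ?V = "ball_perms n R" and ?X = "perm_sum n R b"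
  let ?S = "A \<times> ?V"
  define B where "B = real (card ?S) * (C / c) ^ (4 * 2 ^ i)"
  have count: "real r \<le> B"
    if "orthonormal_on ?S r \<xi>" "\<And>j. j < r \<Longrightarrow> c < cnorm_on ?S (mat_vec ?S ?X (\<xi> j))" for r \<xi>
  proof -
    have "real r * c ^ (4 * 2 ^ i) \<le> real (card ?S) * C ^ (2 * (2 * 2 ^ i))"
    proof (rule orthonormal_on_large_count_le[OF _ that(1)])
      show "cmod ((gram ?S ?X ^^ (2 * 2 ^ i)) (basis_vec z) z) \<le> C ^ (2 * (2 * 2 ^ i))"
        if "z \<in> ?S" for z
        using radius by (intro gram_perm_sum_moment_le finite_A C_nonneg tree_le that) simp
    qed (use that c_pos finite_A finite_ball_perms in \<open>auto simp: less_imp_le\<close>)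
    then show ?thesis using c_pos by (simp add: B_def power_divide pos_le_divide_eq)
  qed
  obtain e where projection_e: "projection_on ?V e"
    and trace_e: "real (card ?V) - real (card A) * B \<le> Re (mat_trace ?V e)"
    and e_cuts: "\<And>f. cnorm_on ?S (mat_vec ?S ?X (amplify ?V e f)) \<le> c * cnorm_on ?S f"
    using c_pos
    by (rule projection_on_cutting_large_directions[OF finite_A finite_ball_perms less_imp_le count])
      blast+
  have "real (card A) * B = real (card ?V) * ((real (card A))\<^sup>2 * (C / c) ^ (4 * 2 ^ i))"
    by (simp add: B_def card_cartesian_product power2_eq_square)
  also have "\<dots> \<le> real (card ?V) * \<delta>" using \<delta>_ge by (intro mult_left_mono) auto
  finally have "real (card ?V) * (1 - \<delta>) \<le> Re (mat_trace ?V e)"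
    using trace_e by (simp add: algebra_simps)
  then show ?thesis
    using that projection_e e_cuts by (simp add: mat_norm_le_def mat_vec_tensor_sum_amplify)
qed

section \<open>Norms of operator spaces as operator bounds\<close>

lemma L2_set_norm_sum_le:
  fixes f :: "'c \<Rightarrow> 'i \<Rightarrow> 'a::real_normed_vector"
  assumes "finite J"
  shows "L2_set (\<lambda>i. norm (\<Sum>c\<in>J. f c i)) A \<le> (\<Sum>c\<in>J. L2_set (\<lambda>i. norm (f c i)) A)"
  using assms
proof induction
  case (insert c J)
  have "L2_set (\<lambda>i. norm (\<Sum>c\<in>insert c J. f c i)) A \<le>
      L2_set (\<lambda>i. norm (f c i) + norm (\<Sum>c\<in>J. f c i)) A"
    using insert by (intro L2_set_mono) (auto intro: norm_triangle_ineq)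
  also have "\<dots> \<le> L2_set (\<lambda>i. norm (f c i)) A + L2_set (\<lambda>i. norm (\<Sum>c\<in>J. f c i)) A"
    by (rule L2_set_triangle_ineq)
  finally show ?case using insert by simp
qed (simp add: L2_set_def)

lemma SUP_unit_ball_le_iff:
  fixes G N :: "'a::complex_vector \<Rightarrow> real"
  assumes G_scale: "\<And>t x. 0 < t \<Longrightarrow> G (complex_of_real t *\<^sub>C x) = t * G x"
    and N_scale: "\<And>t x. 0 < t \<Longrightarrow> N (complex_of_real t *\<^sub>C x) = t * N x"
    and N_nonneg: "\<And>x. 0 \<le> N x" and r_nonneg: "0 \<le> r"
  shows "(SUP x\<in>{x. N x \<le> 1}. ereal (G x)) \<le> ereal r \<longleftrightarrow> (\<forall>x. G x \<le> r * N x)"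
proof
  assume SUP_le: "(SUP x\<in>{x. N x \<le> 1}. ereal (G x)) \<le> ereal r"
  have G_le: "G x \<le> r * t" if "N x < t" for x t
  proof -
    have t_pos: "0 < t" using N_nonneg[of x] that by linarith
    define y where "y = complex_of_real (1 / t) *\<^sub>C x"
    have "N y = 1 / t * N x" unfolding y_def using t_pos by (intro N_scale) simp
    then have "N y \<le> 1" using that t_pos by simp
    with SUP_le have "G y \<le> r" by (auto simp: SUP_le_iff)
    moreover have "G y = 1 / t * G x" unfolding y_def using t_pos by (intro G_scale) simp
    ultimately show ?thesis using t_pos by (simp add: pos_divide_le_eq)
  qed
  show "\<forall>x. G x \<le> r * N x"
  proof
    fix x
    show "G x \<le> r * N x"
    proof (rule field_le_epsilon)
      fix e :: real assume e_pos: "0 < e"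
      have "G x \<le> r * (N x + e / (r + 1))" using r_nonneg e_pos by (intro G_le) simp
      also have "\<dots> \<le> r * N x + e" using r_nonneg e_pos by (simp add: field_simps)
      finally show "G x \<le> r * N x + e" .
    qed
  qed
next
  assume G_le_N: "\<forall>x. G x \<le> r * N x"
  show "(SUP x\<in>{x. N x \<le> 1}. ereal (G x)) \<le> ereal r"
  proof (rule SUP_least)
    fix x assume "x \<in> {x. N x \<le> 1}"
    then have "r * N x \<le> r" using mult_left_mono[of "N x" 1 r] r_nonneg by simp
    then show "ereal (G x) \<le> ereal r" using G_le_N order_trans by auto
  qed
qed

lemma scaleC_entry: "(c *\<^sub>C x) i j = c * x i j" for x :: "'i \<Rightarrow> 'j \<Rightarrow> complex"
  by (simp add: scaleC_fun_def scaleC_complex_def)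

lemma L2_set_Times:
  "L2_set (\<lambda>i. L2_set (\<lambda>p. cmod (f i p)) B) A = cnorm_on (A \<times> B) (case_prod f)"
  by (simp add: L2_set_def cnorm_on_def sum_nonneg sum.cartesian_product case_prod_beta)

lemma os_norm_matrix_opspace_le_iff:
  assumes "0 \<le> r"
  shows "os_norm (matrix_opspace k E) l A \<le> ereal r \<longleftrightarrow>
    mat_norm_le ({..<l} \<times> {..<k}) (\<lambda>(i, p) (j, q). A i j p q) r"
proof -
  let ?S = "{..<l} \<times> {..<k}" and ?A = "\<lambda>(i, p) (j, q). A i j p q"
  define N where "N x = L2_set (\<lambda>j. L2_set (\<lambda>q. cmod (x j q)) {..<k}) {..<l}"
    for x :: "nat \<Rightarrow> nat \<Rightarrow> complex"
  define G where "G x =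
      L2_set (\<lambda>i. L2_set (\<lambda>p. cmod (\<Sum>j<l. \<Sum>q<k. A i j p q * x j q)) {..<k}) {..<l}"
    for x
  have N_eq: "N x = cnorm_on ?S (case_prod x)" for x
    by (simp add: N_def L2_set_Times)
  have G_eq: "G x = cnorm_on ?S (mat_vec ?S ?A (case_prod x))" for x
    unfolding G_def L2_set_Times
    by (intro cnorm_on_cong) (auto simp: mat_vec_def sum.cartesian_product')
  have scale: "case_prod (complex_of_real t *\<^sub>C x) = (\<lambda>z. complex_of_real t * case_prod x z)"
    for t and x :: "nat \<Rightarrow> nat \<Rightarrow> complex"
    by (auto simp: scaleC_entry)
  have "os_norm (matrix_opspace k E) l A \<le> ereal r \<longleftrightarrow> (\<forall>x. G x \<le> r * N x)"
    unfolding matrix_opspace_def opspace.simps G_def[symmetric] unfolding N_def[symmetric]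
    by (rule SUP_unit_ball_le_iff)
      (use assms in \<open>simp_all add: N_eq G_eq scale mat_vec_scale cnorm_on_scale\<close>)
  also have "\<dots> \<longleftrightarrow> mat_norm_le ?S ?A r"
    unfolding mat_norm_le_def N_eq G_eq by (metis case_prod_curry)
  finally show ?thesis .
qed

lemma os_norm_concrete_opspace_le_iff:
  assumes "0 \<le> r"
  shows "os_norm (concrete_opspace F) l A \<le> ereal r \<longleftrightarrow>
    (\<forall>x. L2_set (\<lambda>i. norm (\<Sum>j<l. blinfun_apply (A i j) (x j))) {..<l}
      \<le> r * L2_set (\<lambda>j. norm (x j)) {..<l})"
proof -
  have scale: "(complex_of_real t *\<^sub>C x) j = t *\<^sub>R x j" for t j and x :: "nat \<Rightarrow> ell2"
    by (simp add: scaleC_fun_def scaleR_scaleC)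
  show ?thesis
    unfolding concrete_opspace_def opspace.simps
    by (rule SUP_unit_ball_le_iff)
      (use assms in \<open>simp_all add: scale blinfun.scaleR_right L2_set_right_distrib
        flip: scaleR_sum_right\<close>)
qed

definition block_diagonal :: "('p \<Rightarrow> 'l \<Rightarrow> 'l \<Rightarrow> complex) \<Rightarrow> 'l \<times> 'p \<Rightarrow> 'l \<times> 'p \<Rightarrow> complex" where
  "block_diagonal B = (\<lambda>(i, p) (j, q). of_bool (q = p) * B p i j)"

lemma cnorm_on_block_diagonal_power2:
  assumes "finite P"
  shows "(cnorm_on (L \<times> P) (mat_vec (L \<times> P) (block_diagonal B) f))\<^sup>2 =
    (\<Sum>p\<in>P. (cnorm_on L (mat_vec L (B p) (\<lambda>j. f (j, p))))\<^sup>2)"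
proof -
  have "mat_vec (L \<times> P) (block_diagonal B) f (i, p) = mat_vec L (B p) (\<lambda>j. f (j, p)) i"
    if "p \<in> P" for i p
    unfolding mat_vec_def sum.cartesian_product' block_diagonal_def using assms that
    by (intro sum.cong refl) (simp add: of_bool_def if_distrib[of "\<lambda>x. x * _"] cong: if_cong)
  then show ?thesis by (simp add: cnorm_on_Times_power2_swap)
qed

lemma mat_norm_le_block_diagonal:
  fixes L :: "'l set" and P :: "'p set"
  assumes finite_P: "finite P" and r_nonneg: "0 \<le> r"
  shows "mat_norm_le (L \<times> P) (block_diagonal B) r \<longleftrightarrow> (\<forall>p\<in>P. mat_norm_le L (B p) r)"
proof (intro iffI ballI)
  fix p assume B_le: "mat_norm_le (L \<times> P) (block_diagonal B) r" and p_in: "p \<in> P"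
  show "mat_norm_le L (B p) r"
    unfolding mat_norm_le_def
  proof
    fix y :: "'l \<Rightarrow> complex"
    define f where "f = (\<lambda>(j, q). of_bool (q = p) * y j)"
    have column: "(\<Sum>q\<in>P. (cmod (of_bool (q = p)) * N q)\<^sup>2) = (N p)\<^sup>2" for N
      using finite_P p_in by (simp add: power_mult_distrib of_bool_def if_distrib[of "\<lambda>x. x\<^sup>2"]
          if_distrib[of cmod] if_distrib[of "\<lambda>x. x * _"] cong: if_cong)
    have "(cnorm_on (L \<times> P) (mat_vec (L \<times> P) (block_diagonal B) f))\<^sup>2 =
        (cnorm_on L (mat_vec L (B p) y))\<^sup>2"
      by (simp only: cnorm_on_block_diagonal_power2[OF finite_P] f_def prod.case mat_vec_scale
          cnorm_on_scale column)
    moreover have "(cnorm_on (L \<times> P) f)\<^sup>2 = (cnorm_on L y)\<^sup>2"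
      by (simp only: cnorm_on_Times_power2_swap f_def prod.case cnorm_on_scale column)
    ultimately show "cnorm_on L (mat_vec L (B p) y) \<le> r * cnorm_on L y"
      using mat_norm_leD[OF B_le, of f] by simp
  qed
next
  assume B_le: "\<forall>p\<in>P. mat_norm_le L (B p) r"
  show "mat_norm_le (L \<times> P) (block_diagonal B) r"
    unfolding mat_norm_le_def
  proof
    fix f
    have "(cnorm_on (L \<times> P) (mat_vec (L \<times> P) (block_diagonal B) f))\<^sup>2 \<le>
        (\<Sum>p\<in>P. (r * cnorm_on L (\<lambda>j. f (j, p)))\<^sup>2)"
      unfolding cnorm_on_block_diagonal_power2[OF finite_P] using B_le
      by (intro sum_mono power_mono mat_norm_leD) auto
    also have "\<dots> = (r * cnorm_on (L \<times> P) f)\<^sup>2"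
      by (simp add: power_mult_distrib cnorm_on_Times_power2_swap sum_distrib_left)
    finally show "cnorm_on (L \<times> P) (mat_vec (L \<times> P) (block_diagonal B) f) \<le> r * cnorm_on (L \<times> P) f"
      using r_nonneg by (meson power2_le_imp_le mult_nonneg_nonneg cnorm_on_nonneg)
  qed
qed

lemma carrier_ell_infty: "os_carrier (ell_infty n) = {a. \<forall>i j. a i j \<noteq> 0 \<longrightarrow> i = j \<and> i < n}"
  by (simp add: ell_infty_def matrix_opspace_def)

lemma os_norm_ell_infty_le_iff:
  assumes X_in: "\<And>i j. i < l \<Longrightarrow> j < l \<Longrightarrow> X i j \<in> os_carrier (ell_infty n)" and r_nonneg: "0 \<le> r"
  shows "os_norm (ell_infty n) l X \<le> ereal r \<longleftrightarrow> (\<forall>c<n. mat_norm_le {..<l} (\<lambda>i j. X i j c c) r)"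
proof -
  let ?S = "{..<l} \<times> {..<n}"
  have off_diagonal: "X i j p q = 0" if "i < l" "j < l" "p \<noteq> q" for i j p q
    using X_in[OF that(1,2)] that(3) by (auto simp: carrier_ell_infty)
  have "os_norm (ell_infty n) l X \<le> ereal r \<longleftrightarrow> mat_norm_le ?S (\<lambda>(i, p) (j, q). X i j p q) r"
    unfolding ell_infty_def by (rule os_norm_matrix_opspace_le_iff[OF r_nonneg])
  also have "\<dots> \<longleftrightarrow> mat_norm_le ?S (block_diagonal (\<lambda>p i j. X i j p p)) r"
    by (intro mat_norm_le_cong) (auto simp: off_diagonal block_diagonal_def)
  also have "\<dots> \<longleftrightarrow> (\<forall>c<n. mat_norm_le {..<l} (\<lambda>i j. X i j c c) r)"
    using mat_norm_le_block_diagonal[OF finite_lessThan r_nonneg, where B = "\<lambda>p i j. X i j p p"]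
    by auto
  finally show ?thesis .
qed

section \<open>The dual of \<open>\<ell>\<^sub>\<infinity>\<^sup>n\<close>\<close>

definition diag_functional :: "nat \<Rightarrow> (nat \<Rightarrow> complex) \<Rightarrow> (nat \<Rightarrow> nat \<Rightarrow> complex) \<Rightarrow> complex" where
  "diag_functional n t x = (if x \<in> os_carrier (ell_infty n) then \<Sum>c<n. t c * x c c else 0)"

lemma mat_norm_le_singleton: "mat_norm_le {..<1::nat} (\<lambda>_ _. t) r \<longleftrightarrow> cmod t \<le> r"
proof
  assume "mat_norm_le {..<1::nat} (\<lambda>_ _. t) r"
  from mat_norm_leD[OF this, of "\<lambda>_. 1"] show "cmod t \<le> r"
    by (simp add: cnorm_on_def mat_vec_def L2_set_def)
qed (auto simp: mat_norm_le_def cnorm_on_def mat_vec_def L2_set_def norm_mult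
    intro!: mult_right_mono)

lemma os_norm_matrix_opspace_nonneg: "0 \<le> os_norm (matrix_opspace k E) l A"
  unfolding matrix_opspace_def opspace.simps
  by (rule SUP_upper2[where i = "\<lambda>_ _. 0"]) (simp_all add: L2_set_def)

lemma diag_functional_bounded:
  assumes x_in: "x \<in> os_carrier (ell_infty n)"
  shows "ereal (cmod (diag_functional n t x)) \<le>
    ereal ((\<Sum>c<n. cmod (t c)) + 1) * os_norm (ell_infty n) 1 (\<lambda>_ _. x)"
proof -
  have nonneg: "0 \<le> os_norm (ell_infty n) 1 (\<lambda>_ _. x)"
    unfolding ell_infty_def by (rule os_norm_matrix_opspace_nonneg)
  show ?thesis
  proof (cases "os_norm (ell_infty n) 1 (\<lambda>_ _. x)")
    case (real r)
    then have r_nonneg: "0 \<le> r" using nonneg by simp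
    have "cmod (x c c) \<le> r" if "c < n" for c
      using os_norm_ell_infty_le_iff[of 1 "\<lambda>_ _. x" n r] x_in r_nonneg real that
      by (simp add: mat_norm_le_singleton[simplified])
    then have "cmod (\<Sum>c<n. t c * x c c) \<le> (\<Sum>c<n. cmod (t c) * r)"
      by (intro order_trans[OF norm_sum] sum_mono) (auto simp: norm_mult intro!: mult_left_mono)
    also have "\<dots> \<le> ((\<Sum>c<n. cmod (t c)) + 1) * r"
      unfolding sum_distrib_right[symmetric] using r_nonneg by (intro mult_right_mono) auto
    finally show ?thesis using real x_in by (simp add: diag_functional_def)
  next
    case PInf
    have "0 < (\<Sum>c<n. cmod (t c)) + 1" by (intro add_nonneg_pos sum_nonneg) auto
    then show ?thesis using PInf by simp
  qed (use nonneg in simp)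
qed

lemma diag_functional_eq_0: "x \<notin> os_carrier (ell_infty n) \<Longrightarrow> diag_functional n t x = 0"
  by (simp add: diag_functional_def)

lemma diag_functional_in_carrier: "diag_functional n t \<in> os_carrier (E1 n)"
proof -
  have "x + y \<in> os_carrier (ell_infty n)" "c *\<^sub>C x \<in> os_carrier (ell_infty n)"
    if "x \<in> os_carrier (ell_infty n)" "y \<in> os_carrier (ell_infty n)" for c x y
    using that by (auto simp: carrier_ell_infty scaleC_entry) (metis add_0)+
  then have "clinear_on (os_carrier (ell_infty n)) (diag_functional n t)"
    by (auto simp: clinear_on_def diag_functional_def scaleC_entry scaleC_complex_def
        sum_distrib_left algebra_simps sum.distrib)
  then show ?thesis
    unfolding E1_def dual_opspace_def
    using diag_functional_bounded[of _ n t] by (auto simp: diag_functional_eq_0)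
qed

text \<open>
  \<open>E1_norm_le n S y r\<close> states \<open>\<parallel>\<Sum> e\<^sub>c \<otimes> y\<^sub>c\<parallel> \<le> r\<close> for matrices \<open>y\<^sub>c\<close> over \<open>S\<close>, the norm being the
  supremum of \<open>\<parallel>\<Sum> z\<^sub>c \<otimes> y\<^sub>c\<parallel>\<close> over contractive matrices \<open>z\<^sub>c\<close>.
\<close>

definition E1_norm_le :: "nat \<Rightarrow> 'v set \<Rightarrow> (nat \<Rightarrow> 'v \<Rightarrow> 'v \<Rightarrow> complex) \<Rightarrow> real \<Rightarrow> bool" where
  "E1_norm_le n S y r \<longleftrightarrow>
    (\<forall>l z. (\<forall>c<n. mat_norm_le {..<l::nat} (z c) 1) \<longrightarrow> mat_norm_le ({..<l} \<times> S) (tensor_sum n z y) r)"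

lemma os_norm_E1:
  "os_norm (E1 n) m Z =
    (SUP l\<in>{1..}. SUP X\<in>{X. (\<forall>i<l. \<forall>j<l. X i j \<in> os_carrier (ell_infty n)) \<and>
        os_norm (ell_infty n) l X \<le> 1}.
      os_norm (Mat m) l (\<lambda>i j s t. if s < m \<and> t < m then Z s t (X i j) else 0))"
  by (simp add: E1_def dual_opspace_def cb_norm_def)

lemma os_norm_Mat_diag_functional_le_iff:
  assumes "\<And>i j. i < l \<Longrightarrow> j < l \<Longrightarrow> X i j \<in> os_carrier (ell_infty n)" and r_nonneg: "0 \<le> r"
  shows "os_norm (Mat m) l
      (\<lambda>i j s t. if s < m \<and> t < m then diag_functional n (\<lambda>c. y c s t) (X i j) else 0) \<le> ereal r \<longleftrightarrow>
    mat_norm_le ({..<l} \<times> {..<m}) (tensor_sum n (\<lambda>c i j. X i j c c) y) r"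
  unfolding Mat_def os_norm_matrix_opspace_le_iff[OF r_nonneg]
  using assms(1)
  by (intro mat_norm_le_cong) (auto simp: tensor_sum_def diag_functional_def mult.commute)

lemma E1_norm_le_of_os_norm_E1_le:
  assumes r_nonneg: "0 \<le> r"
    and os_norm_le: "os_norm (E1 n) m (\<lambda>s t. diag_functional n (\<lambda>c. y c s t)) \<le> ereal r"
  shows "E1_norm_le n {..<m} y r"
  unfolding E1_norm_le_def
proof (intro allI impI)
  fix l :: nat and z
  assume contractive: "\<forall>c<n. mat_norm_le {..<l} (z c) 1"
  show "mat_norm_le ({..<l} \<times> {..<m}) (tensor_sum n z y) r"
  proof (cases "l = 0")
    case True
    then show ?thesis by (simp add: mat_norm_le_def cnorm_on_def)
  next
    case False
    define X where "X i j p q = (if p = q \<and> p < n then z p i j else 0)" for i j p q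
    have X_in: "X i j \<in> os_carrier (ell_infty n)" for i j by (auto simp: X_def carrier_ell_infty)
    have "os_norm (ell_infty n) l X \<le> ereal 1"
      using contractive by (subst os_norm_ell_infty_le_iff) (simp_all add: X_in X_def)
    then have "os_norm (Mat m) l
        (\<lambda>i j s t. if s < m \<and> t < m then diag_functional n (\<lambda>c. y c s t) (X i j) else 0) \<le> ereal r"
      using os_norm_le X_in False by (simp add: os_norm_E1 SUP_le_iff one_ereal_def)
    then have "mat_norm_le ({..<l} \<times> {..<m}) (tensor_sum n (\<lambda>c i j. X i j c c) y) r"
      using os_norm_Mat_diag_functional_le_iff[of l X n r m y] X_in r_nonneg by blast
    moreover have "tensor_sum n (\<lambda>c i j. X i j c c) y = tensor_sum n z y"
      by (auto simp: tensor_sum_def X_def)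
    ultimately show ?thesis by simp
  qed
qed

lemma os_norm_E1_le_of_E1_norm_le:
  assumes r_nonneg: "0 \<le> r" and y_le: "E1_norm_le n {..<m} y r"
  shows "os_norm (E1 n) m (\<lambda>s t. diag_functional n (\<lambda>c. y c s t)) \<le> ereal r"
  unfolding os_norm_E1
proof (intro SUP_least)
  fix l :: nat and X :: "nat \<Rightarrow> nat \<Rightarrow> nat \<Rightarrow> nat \<Rightarrow> complex"
  assume X_unit: "X \<in> {X. (\<forall>i<l. \<forall>j<l. X i j \<in> os_carrier (ell_infty n)) \<and>
    os_norm (ell_infty n) l X \<le> 1}"
  then have "\<forall>c<n. mat_norm_le {..<l} (\<lambda>i j. X i j c c) 1"
    using os_norm_ell_infty_le_iff[of l X n 1] by (simp add: one_ereal_def)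
  then have "mat_norm_le ({..<l} \<times> {..<m}) (tensor_sum n (\<lambda>c i j. X i j c c) y) r"
    using y_le by (simp add: E1_norm_le_def)
  then show "os_norm (Mat m) l
      (\<lambda>i j s t. if s < m \<and> t < m then diag_functional n (\<lambda>c. y c s t) (X i j) else 0) \<le> ereal r"
    using X_unit r_nonneg by (subst os_norm_Mat_diag_functional_le_iff) auto
qed

lemma os_norm_E1_le_iff:
  "0 \<le> r \<Longrightarrow> os_norm (E1 n) m (\<lambda>s t. diag_functional n (\<lambda>c. y c s t)) \<le> ereal r \<longleftrightarrow>
    E1_norm_le n {..<m} y r"
  using E1_norm_le_of_os_norm_E1_le os_norm_E1_le_of_E1_norm_le by blast

lemma E1_norm_le_reindex:
  assumes "bij_betw h S T"
  shows "E1_norm_le n S (\<lambda>c v w. y c (h v) (h w)) r \<longleftrightarrow> E1_norm_le n T y r"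
proof -
  have "mat_norm_le ({..<l} \<times> S) (tensor_sum n z (\<lambda>c v w. y c (h v) (h w))) r \<longleftrightarrow>
      mat_norm_le ({..<l} \<times> T) (tensor_sum n z y) r" for l :: nat and z
  proof -
    have "bij_betw (map_prod id h) ({..<l} \<times> S) ({..<l} \<times> T)"
      by (intro bij_betw_map_prod assms bij_betw_id)
    from mat_norm_le_reindex[OF this] show ?thesis
      using tensor_sum_reindex[of n z id y h] by (simp only: id_apply)
  qed
  then show ?thesis by (simp add: E1_norm_le_def)
qed

lemma E1_norm_le_divide_iff:
  "0 < t \<Longrightarrow> E1_norm_le n S (\<lambda>c v w. y c v w / complex_of_real t) r \<longleftrightarrow> E1_norm_le n S y (t * r)"
  by (simp add: E1_norm_le_def tensor_sum_divide mat_norm_le_divide_iff)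

lemma os_norm_E1_enumeration_le_iff:
  assumes "bij_betw h {..<m} S" "0 < t" "0 \<le> r"
  shows "os_norm (E1 n) m (\<lambda>i j. diag_functional n (\<lambda>c. y c (h i) (h j) / complex_of_real t))
      \<le> ereal r \<longleftrightarrow>
    E1_norm_le n S y (t * r)"
  using assms
  by (simp add: os_norm_E1_le_iff E1_norm_le_divide_iff E1_norm_le_reindex[OF assms(1)])

lemma E1_norm_leD:
  assumes y_le: "E1_norm_le n S y r" and finite_L: "finite L"
    and contractive: "\<And>c. c < n \<Longrightarrow> mat_norm_le L (z c) 1"
  shows "mat_norm_le (L \<times> S) (tensor_sum n z y) r"
proof -
  obtain h where bij_h: "bij_betw h {..<card L} L"
    using ex_bij_betw_nat_finite[OF finite_L] by (auto simp: atLeast0LessThan)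
  have "mat_norm_le {..<card L} (\<lambda>i j. z c (h i) (h j)) 1" if "c < n" for c
    using contractive[OF that] mat_norm_le_reindex[OF bij_h] by blast
  then have "mat_norm_le ({..<card L} \<times> S)
      (\<lambda>a a'. tensor_sum n z y (map_prod h id a) (map_prod h id a')) r"
    using y_le unfolding E1_norm_le_def tensor_sum_reindex[symmetric] by simp
  moreover have "bij_betw (map_prod h id) ({..<card L} \<times> S) (L \<times> S)"
    by (intro bij_betw_map_prod bij_h bij_betw_id)
  ultimately show ?thesis using mat_norm_le_reindex by blast
qed

text \<open>The pairing of \<open>\<Sum> z\<^sub>c \<otimes> y\<^sub>c\<close> with the unnormalised maximally entangled vector.\<close>

lemma E1_norm_le_pairing:
  fixes V :: "'v set"
  assumes finite_V: "finite V" and y_le: "E1_norm_le n V y r"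
    and contractive: "\<And>c. c < n \<Longrightarrow> mat_norm_le V (z c) 1"
  shows "cmod (\<Sum>c<n. \<Sum>v\<in>V. \<Sum>w\<in>V. z c v w * y c v w) \<le> r * real (card V)"
proof -
  let ?S = "V \<times> V" and ?T = "tensor_sum n z y"
  define \<Omega> :: "'v \<times> 'v \<Rightarrow> complex" where "\<Omega> = (\<lambda>(v, w). of_bool (w = v))"
  have diagonal: "(\<Sum>a\<in>?S. g a * \<Omega> a) = (\<Sum>v\<in>V. g (v, v))" for g
    unfolding sum.cartesian_product' \<Omega>_def
    using finite_V
    by (intro sum.cong refl) (simp add: of_bool_def if_distrib[of "\<lambda>x. _ * x"] cong: if_cong)
  have inner_\<Omega>: "cinner_on ?S \<Omega> g = (\<Sum>v\<in>V. g (v, v))" for g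
    unfolding cinner_on_def diagonal[symmetric]
    by (intro sum.cong refl) (simp add: \<Omega>_def case_prod_beta mult.commute)
  have norm_\<Omega>: "(cnorm_on ?S \<Omega>)\<^sup>2 = real (card V)"
    unfolding cmod_cinner_on_self[symmetric] inner_\<Omega> by (simp add: \<Omega>_def)
  have "cinner_on ?S \<Omega> (mat_vec ?S ?T \<Omega>) = (\<Sum>v\<in>V. \<Sum>w\<in>V. \<Sum>c<n. z c v w * y c v w)"
    unfolding inner_\<Omega> by (simp add: mat_vec_def diagonal tensor_sum_def)
  also have "\<dots> = (\<Sum>v\<in>V. \<Sum>c<n. \<Sum>w\<in>V. z c v w * y c v w)"
    by (intro sum.cong refl sum.swap)
  also have "\<dots> = (\<Sum>c<n. \<Sum>v\<in>V. \<Sum>w\<in>V. z c v w * y c v w)" by (rule sum.swap)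
  finally have "cmod (\<Sum>c<n. \<Sum>v\<in>V. \<Sum>w\<in>V. z c v w * y c v w) \<le>
      cnorm_on ?S \<Omega> * cnorm_on ?S (mat_vec ?S ?T \<Omega>)"
    by (metis cmod_cinner_on_le)
  also have "\<dots> \<le> cnorm_on ?S \<Omega> * (r * cnorm_on ?S \<Omega>)"
    by (intro mult_left_mono mat_norm_leD E1_norm_leD y_le finite_V contractive cnorm_on_nonneg)
  also have "\<dots> = r * real (card V)" by (simp add: norm_\<Omega>[symmetric] power2_eq_square)
  finally show ?thesis .
qed

lemma Schur_test:
  fixes K :: "'v \<Rightarrow> 'v \<Rightarrow> real"
  assumes K_nonneg: "\<And>s t. 0 \<le> K s t" and h_pos: "\<And>s. s \<in> S \<Longrightarrow> 0 < h s" and D_nonneg: "0 \<le> D"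
    and rows: "\<And>s. s \<in> S \<Longrightarrow> (\<Sum>t\<in>S. K s t * h t) \<le> D * h s"
    and columns: "\<And>t. t \<in> S \<Longrightarrow> (\<Sum>s\<in>S. K s t * h s) \<le> D * h t"
  shows "(\<Sum>s\<in>S. (\<Sum>t\<in>S. K s t * G t)\<^sup>2) \<le> D\<^sup>2 * (\<Sum>t\<in>S. (G t)\<^sup>2)"
proof -
  have row_le: "(\<Sum>t\<in>S. K s t * G t)\<^sup>2 \<le> D * h s * (\<Sum>t\<in>S. K s t * ((G t)\<^sup>2 / h t))"
    if s_in: "s \<in> S" for s
  proof -
    have "(\<Sum>t\<in>S. K s t * G t) = (\<Sum>t\<in>S. sqrt (K s t * h t) * (sqrt (K s t / h t) * G t))"
    proof (intro sum.cong refl)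
      fix t assume "t \<in> S"
      then have "sqrt (K s t * h t) * sqrt (K s t / h t) = sqrt (K s t * K s t)"
        using h_pos[of t] by (simp add: real_sqrt_mult[symmetric])
      then show "K s t * G t = sqrt (K s t * h t) * (sqrt (K s t / h t) * G t)"
        using K_nonneg[of s t] by (simp add: mult.assoc[symmetric])
    qed
    also have "\<dots>\<^sup>2 \<le> (\<Sum>t\<in>S. (sqrt (K s t * h t))\<^sup>2) * (\<Sum>t\<in>S. (sqrt (K s t / h t) * G t)\<^sup>2)"
      by (rule Cauchy_Schwarz_ineq_sum)
    also have "\<dots> = (\<Sum>t\<in>S. K s t * h t) * (\<Sum>t\<in>S. K s t * ((G t)\<^sup>2 / h t))"
      using K_nonneg h_pos by (simp add: power_mult_distrib less_imp_le)
    also have "\<dots> \<le> D * h s * (\<Sum>t\<in>S. K s t * ((G t)\<^sup>2 / h t))"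
      using K_nonneg h_pos by (intro mult_right_mono rows s_in sum_nonneg) (simp add: less_imp_le)
    finally show ?thesis .
  qed
  have "(\<Sum>s\<in>S. (\<Sum>t\<in>S. K s t * G t)\<^sup>2) \<le> (\<Sum>s\<in>S. \<Sum>t\<in>S. D * h s * (K s t * ((G t)\<^sup>2 / h t)))"
    unfolding sum_distrib_left[symmetric] by (intro sum_mono row_le)
  also have "\<dots> = D * (\<Sum>t\<in>S. (\<Sum>s\<in>S. K s t * h s) * ((G t)\<^sup>2 / h t))"
    by (subst sum.swap) (simp add: sum_distrib_left sum_divide_distrib mult_ac)
  also have "\<dots> \<le> D * (\<Sum>t\<in>S. D * h t * ((G t)\<^sup>2 / h t))"
    using h_pos
    by (intro mult_left_mono sum_mono mult_right_mono columns D_nonneg) (auto simp: less_imp_le)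
  also have "(\<Sum>t\<in>S. D * h t * ((G t)\<^sup>2 / h t)) = D * (\<Sum>t\<in>S. (G t)\<^sup>2)"
    unfolding sum_distrib_left using h_pos by (intro sum.cong refl) (fastforce dest: h_pos)
  finally show ?thesis by (simp add: power2_eq_square mult.assoc)
qed

lemma E1_norm_le_Schur:
  fixes S :: "'v set"
  assumes finite_S: "finite S" and h_pos: "\<And>s. s \<in> S \<Longrightarrow> 0 < h s" and D_nonneg: "0 \<le> D"
    and rows: "\<And>s. s \<in> S \<Longrightarrow> (\<Sum>t\<in>S. (\<Sum>c<n. cmod (y c s t)) * h t) \<le> D * h s"
    and columns: "\<And>t. t \<in> S \<Longrightarrow> (\<Sum>s\<in>S. (\<Sum>c<n. cmod (y c s t)) * h s) \<le> D * h t"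
  shows "E1_norm_le n S y D"
  unfolding E1_norm_le_def mat_norm_le_def[of "{..<_} \<times> S"]
proof (intro allI impI)
  fix l :: nat and z and f :: "nat \<times> 'v \<Rightarrow> complex"
  assume contractive: "\<forall>c<n. mat_norm_le {..<l} (z c) 1"
  define G where "G t = cnorm_on {..<l} (\<lambda>j. f (j, t))" for t
  let ?S = "{..<l} \<times> S" and ?K = "\<lambda>s t. \<Sum>c<n. cmod (y c s t)"
  let ?g = "mat_vec ?S (tensor_sum n z y) f"
  have column_le: "cnorm_on {..<l} (\<lambda>i. ?g (i, s)) \<le> (\<Sum>t\<in>S. ?K s t * G t)" for s
  proof -
    let ?w = "\<lambda>(c, t) i. y c s t * mat_vec {..<l} (z c) (\<lambda>j. f (j, t)) i"
    have "?g (i, s) = (\<Sum>a\<in>{..<n} \<times> S. ?w a i)" for i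
      unfolding mat_vec_tensor_sum_swap by (simp add: sum.cartesian_product case_prod_beta)
    then have "cnorm_on {..<l} (\<lambda>i. ?g (i, s)) \<le> (\<Sum>a\<in>{..<n} \<times> S. cnorm_on {..<l} (?w a))"
      unfolding cnorm_on_def using L2_set_norm_sum_le[of "{..<n} \<times> S" "?w" "{..<l}"] finite_S
      by simp
    also have "\<dots> \<le> (\<Sum>(c, t)\<in>{..<n} \<times> S. cmod (y c s t) * G t)"
      using mat_norm_leD contractive unfolding G_def
      by (intro sum_mono) (fastforce simp: cnorm_on_scale intro!: mult_left_mono)
    also have "\<dots> = (\<Sum>t\<in>S. ?K s t * G t)"
      unfolding sum_distrib_right by (subst sum.swap) (simp add: sum.cartesian_product)
    finally show ?thesis .
  qed
  have "(cnorm_on ?S ?g)\<^sup>2 \<le> (\<Sum>s\<in>S. (\<Sum>t\<in>S. ?K s t * G t)\<^sup>2)"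
    unfolding cnorm_on_Times_power2_swap using column_le by (intro sum_mono power_mono) auto
  also have "\<dots> \<le> D\<^sup>2 * (\<Sum>t\<in>S. (G t)\<^sup>2)"
    by (rule Schur_test[OF _ h_pos D_nonneg rows columns]) (auto intro: sum_nonneg)
  also have "\<dots> = (D * cnorm_on ?S f)\<^sup>2"
    unfolding power_mult_distrib cnorm_on_Times_power2_swap G_def ..
  finally show "cnorm_on ?S ?g \<le> D * cnorm_on ?S f"
    using D_nonneg by (meson power2_le_imp_le mult_nonneg_nonneg cnorm_on_nonneg)
qed

text \<open>
  The weight \<open>(n - 1)\<^sup>-\<^sup>l\<^sup>/\<^sup>2\<close> at distance \<open>l\<close> from the root is a supersolution for the adjacency
  operator of the \<open>n\<close>-regular tree at its spectral radius.
\<close>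

lemma tree_weight_sum_le:
  assumes n_ge_2: "2 \<le> n" and s_in: "s \<in> red_words n R"
  defines "x \<equiv> 1 / sqrt (real n - 1)"
  shows "(\<Sum>c<n. x ^ length (flip c s)) \<le> 2 * sqrt (real n - 1) * x ^ length s"
proof -
  define q where "q = sqrt (real n - 1)"
  have q_pos: "0 < q" and q_square: "q * q = real n - 1"
    and x_eq: "x = 1 / q" using n_ge_2 by (auto simp: q_def x_def)
  then have x_pos: "0 < x" and q_x: "q * x = 1"
    and x_square: "(real n - 1) * (x * x) = 1" by (auto simp flip: q_square)
  have "(\<Sum>c<n. x ^ length (flip c s)) \<le> 2 * q * x ^ length s"
  proof (cases s)
    case Nil
    have "real n * x \<le> 2 * (real n - 1) * x" using n_ge_2 x_pos by (intro mult_right_mono) auto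
    also have "\<dots> = 2 * q * (q * x)" by (simp flip: q_square)
    finally show ?thesis using Nil q_x by (simp add: flip_def)
  next
    case (Cons a t)
    then have a_in: "a \<in> {..<n}" using s_in by (auto simp: red_words_def)
    have "(\<Sum>c<n. x ^ length (flip c s)) =
        x ^ length (flip a s) + (\<Sum>c\<in>{..<n} - {a}. x ^ length (flip c s))"
      using a_in by (intro sum.remove) auto
    also have "(\<Sum>c\<in>{..<n} - {a}. x ^ length (flip c s)) = (\<Sum>c\<in>{..<n} - {a}. x ^ (length t + 2))"
      using Cons by (intro sum.cong) (auto simp: flip_def)
    also have "\<dots> = (real n - 1) * (x * x) * x ^ length t"
      using a_in n_ge_2 by (simp add: card_Diff_singleton of_nat_diff)
    also have "x ^ length (flip a s) + \<dots> = 2 * (q * x) * x ^ length t"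
      using Cons x_pos q_x x_square by (simp add: flip_def)
    finally show ?thesis using Cons by (simp add: mult_ac)
  qed
  then show ?thesis by (simp add: q_def)
qed

lemma E1_norm_le_tree:
  assumes n_ge_2: "2 \<le> n"
  shows "E1_norm_le n (red_words n R) (\<lambda>c. fun_matrix (flip c)) (2 * sqrt (real n - 1))"
proof -
  let ?W = "red_words n R" and ?K = "\<lambda>s t. \<Sum>c<n. cmod (fun_matrix (flip c) s t)"
  define h where "h s = (1 / sqrt (real n - 1)) ^ length s" for s :: "nat list"
  have h_pos: "0 < h s" for s using n_ge_2 by (simp add: h_def)
  have rows: "(\<Sum>t\<in>?W. ?K s t * h t) \<le> 2 * sqrt (real n - 1) * h s" if s_in: "s \<in> ?W" for s
  proof -
    have "(\<Sum>t\<in>?W. ?K s t * h t) = (\<Sum>c<n. \<Sum>t\<in>?W. if t = flip c s then h t else 0)"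
      unfolding sum_distrib_right
      by (subst sum.swap) (auto simp: fun_matrix_def intro!: sum.cong)
    also have "\<dots> \<le> (\<Sum>c<n. h (flip c s))"
      using h_pos by (intro sum_mono) (simp add: finite_red_words less_imp_le)
    also have "\<dots> \<le> 2 * sqrt (real n - 1) * h s"
      unfolding h_def by (rule tree_weight_sum_le[OF n_ge_2 s_in])
    finally show ?thesis .
  qed
  have "?K s t = ?K t s" if "s \<in> ?W" "t \<in> ?W" for s t
    using hermitian_on_flip that unfolding hermitian_on_def
    by (intro sum.cong refl) (metis complex_mod_cnj)
  then have "(\<Sum>s\<in>?W. ?K s t * h s) = (\<Sum>s\<in>?W. ?K t s * h s)" if "t \<in> ?W" for t
    using that by (intro sum.cong) auto
  then show ?thesis
    using n_ge_2 rows h_pos by (intro E1_norm_le_Schur[where h = h] finite_red_words) auto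
qed

section \<open>Truncation of compact operators\<close>

lemma ell2_eqI: "(\<And>i. ell2_nth x i = ell2_nth y i) \<Longrightarrow> x = y"
  by (simp add: ell2_nth_inject[symmetric] fun_eq_iff)

lemma ell2_nth_sum: "ell2_nth (\<Sum>j\<in>J. x j) i = (\<Sum>j\<in>J. ell2_nth (x j) i)"
  by (induction J rule: infinite_finite_induct) (simp_all add: zero_ell2.rep_eq plus_ell2.rep_eq)

lemma summable_ell2: "summable (\<lambda>i. (cmod (ell2_nth x i))\<^sup>2)"
  using ell2_nth[of x] by simp

lemma norm_ell2_power2: "(norm x)\<^sup>2 = (\<Sum>i. (cmod (ell2_nth x i))\<^sup>2)"
  unfolding norm_ell2.rep_eq
  by (rule real_sqrt_pow2) (intro suminf_nonneg summable_ell2 zero_le_power2)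

lemma norm_ell2_finite:
  assumes "\<And>i. k \<le> i \<Longrightarrow> ell2_nth x i = 0"
  shows "norm x = cnorm_on {..<k} (ell2_nth x)"
  unfolding norm_ell2.rep_eq cnorm_on_def L2_set_def
  by (subst suminf_finite[of "{..<k}"]) (auto simp: assms)

lemma cnorm_on_ell2_nth_le: "finite A \<Longrightarrow> cnorm_on A (ell2_nth x) \<le> norm x"
  unfolding cnorm_on_def L2_set_def norm_ell2.rep_eq
  by (intro real_sqrt_le_mono sum_le_suminf summable_ell2) auto

lemma norm_ell2_mono:
  assumes "\<And>i. cmod (ell2_nth x i) \<le> cmod (ell2_nth y i)"
  shows "norm x \<le> norm y"
  unfolding norm_ell2.rep_eq
  by (intro real_sqrt_le_mono suminf_le summable_ell2 power_mono assms) auto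

lift_definition ell2_basis :: "nat \<Rightarrow> ell2" is "\<lambda>q i. if i = q then 1 else 0"
  by (rule summable_finite[of "{q}" for q]) auto

definition ell2_of_coords :: "nat \<Rightarrow> (nat \<Rightarrow> complex) \<Rightarrow> ell2" where
  "ell2_of_coords k f = (\<Sum>q<k. f q *\<^sub>C ell2_basis q)"

lemma ell2_nth_of_coords: "ell2_nth (ell2_of_coords k f) i = (if i < k then f i else 0)"
  by (simp add: ell2_of_coords_def ell2_nth_sum scaleC_ell2.rep_eq ell2_basis.rep_eq
      if_distrib[of "\<lambda>x. _ * x"] cong: if_cong)

lemma norm_ell2_of_coords: "norm (ell2_of_coords k f) = cnorm_on {..<k} f"
  by (subst norm_ell2_finite[of k]) (auto simp: ell2_nth_of_coords intro: cnorm_on_cong)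

lift_definition trunc_op :: "nat \<Rightarrow> ell2 \<Rightarrow>\<^sub>L ell2" is "\<lambda>k x. ell2_of_coords k (ell2_nth x)"
proof (rule bounded_linear_intro[where K = 1])
  show "norm (ell2_of_coords k (ell2_nth x)) \<le> norm x * 1" for k x
    by (simp add: norm_ell2_of_coords cnorm_on_ell2_nth_le)
qed (rule ell2_eqI; simp add: ell2_nth_of_coords plus_ell2.rep_eq scaleR_ell2.rep_eq)+

lift_definition coord_op :: "nat \<Rightarrow> ell2 \<Rightarrow>\<^sub>L complex" is "\<lambda>i x. ell2_nth x i"
proof (rule bounded_linear_intro[where K = 1])
  show "cmod (ell2_nth x i) \<le> norm x * 1" for x i
    using cnorm_on_ell2_nth_le[of "{i}" x] by (simp add: cnorm_on_def)
qed (simp_all add: plus_ell2.rep_eq scaleR_ell2.rep_eq scaleR_conv_of_real)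

lemma ell2_nth_trunc_op: "ell2_nth (trunc_op k x) i = (if i < k then ell2_nth x i else 0)"
  by (simp add: trunc_op.rep_eq ell2_nth_of_coords)

lemma norm_trunc_op_apply_le: "norm (trunc_op k x) \<le> norm x"
  by (rule norm_ell2_mono) (simp add: ell2_nth_trunc_op)

lemma norm_trunc_op_le: "norm (trunc_op k) \<le> 1"
  by (rule norm_blinfun_bound) (simp_all add: norm_trunc_op_apply_le)

lemma norm_id_minus_trunc_op_le: "norm (id_blinfun - trunc_op k) \<le> 1"
proof (rule norm_blinfun_bound)
  show "norm ((id_blinfun - trunc_op k) x) \<le> 1 * norm x" for x
    by (simp add: blinfun.diff_left)
      (rule norm_ell2_mono, simp add: minus_ell2.rep_eq ell2_nth_trunc_op)
qed simp

lemma trunc_op_tendsto: "(\<lambda>k. trunc_op k x) \<longlonglongrightarrow> x"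
proof -
  let ?f = "\<lambda>i. (cmod (ell2_nth x i))\<^sup>2"
  have tail: "(norm (trunc_op k x - x))\<^sup>2 = suminf ?f - sum ?f {..<k}" for k
  proof -
    have "summable (\<lambda>i. if i < k then ?f i else 0)" by (rule summable_finite[of "{..<k}"]) auto
    from suminf_diff[OF summable_ell2[of x] this]
    have "(\<Sum>i. ?f i - (if i < k then ?f i else 0)) = suminf ?f - (\<Sum>i. if i < k then ?f i else 0)" ..
    moreover have "(\<Sum>i. if i < k then ?f i else 0) = sum ?f {..<k}"
      by (subst suminf_finite[of "{..<k}"]) auto
    moreover have "(norm (trunc_op k x - x))\<^sup>2 = (\<Sum>i. ?f i - (if i < k then ?f i else 0))"
      unfolding norm_ell2_power2
      by (intro suminf_cong) (auto simp: minus_ell2.rep_eq ell2_nth_trunc_op)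
    ultimately show ?thesis by simp
  qed
  have "(\<lambda>k. suminf ?f - sum ?f {..<k}) \<longlonglongrightarrow> suminf ?f - suminf ?f"
    by (intro tendsto_intros summable_LIMSEQ summable_ell2)
  then have "(\<lambda>k. sqrt ((norm (trunc_op k x - x))\<^sup>2)) \<longlonglongrightarrow> sqrt 0"
    by (intro tendsto_real_sqrt) (simp add: tail)
  then show ?thesis by (simp add: tendsto_norm_zero_iff LIM_zero_iff)
qed

abbreviation compress :: "nat \<Rightarrow> (ell2 \<Rightarrow>\<^sub>L ell2) \<Rightarrow> ell2 \<Rightarrow>\<^sub>L ell2" where
  "compress k a \<equiv> trunc_op k o\<^sub>L a o\<^sub>L trunc_op k"

lemma norm_blinfun_le_of_unit_ball:
  fixes T :: "'a::real_normed_vector \<Rightarrow>\<^sub>L 'b::real_normed_vector"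
  assumes b_nonneg: "0 \<le> b" and unit_ball_le: "\<And>x. norm x \<le> 1 \<Longrightarrow> norm (T x) \<le> b"
  shows "norm T \<le> b"
proof (rule norm_blinfun_bound[OF b_nonneg])
  fix x
  show "norm (T x) \<le> b * norm x"
  proof (cases "x = 0")
    case False
    then have "norm (T (inverse (norm x) *\<^sub>R x)) \<le> b" by (intro unit_ball_le) simp
    then have "inverse (norm x) * norm (T x) \<le> b" by (simp add: blinfun.scaleR_right)
    with False show ?thesis by (simp add: field_simps)
  qed (simp add: blinfun.zero_right)
qed

lemma compact_operator_trunc_left_tendsto:
  assumes compact_a: "a \<in> compact_operators"
  shows "(\<lambda>k. trunc_op k o\<^sub>L a) \<longlonglongrightarrow> a"
proof (rule tendstoI)
  fix e :: real assume e_pos: "0 < e"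
  let ?S = "closure (blinfun_apply a ` cball 0 1)"
  have "compact ?S" using compact_a by (simp add: compact_operators_def)
  then obtain T where finite_T: "finite T" and T_covers: "?S \<subseteq> (\<Union>y\<in>T. ball y (e / 3))"
    using e_pos unfolding compact_eq_totally_bounded by (meson divide_pos_pos zero_less_numeral)
  have "\<forall>\<^sub>F k in sequentially. \<forall>y\<in>T. dist (trunc_op k y) y < e / 3"
    using tendstoD[OF trunc_op_tendsto, of "e / 3"] e_pos
    by (intro eventually_ball_finite finite_T) simp
  then show "\<forall>\<^sub>F k in sequentially. dist (trunc_op k o\<^sub>L a) a < e"
  proof eventually_elim
    fix k assume net: "\<forall>y\<in>T. dist (trunc_op k y) y < e / 3"
    have "norm ((trunc_op k o\<^sub>L a) - a) \<le> 2 * e / 3"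
    proof (rule norm_blinfun_le_of_unit_ball)
      fix x :: ell2 assume "norm x \<le> 1"
      then have "a x \<in> ?S" by (intro closure_subset[THEN subsetD]) auto
      then obtain y where y_in: "y \<in> T" and y_near: "dist y (a x) < e / 3" using T_covers by auto
      have "((trunc_op k o\<^sub>L a) - a) x = (trunc_op k y - y) - (id_blinfun - trunc_op k) (a x - y)"
        by (simp add: blinfun.diff_left blinfun.diff_right algebra_simps)
      then have "norm (((trunc_op k o\<^sub>L a) - a) x) \<le>
          norm (trunc_op k y - y) + norm ((id_blinfun - trunc_op k) (a x - y))"
        by (metis norm_triangle_ineq4)
      also have "norm ((id_blinfun - trunc_op k) (a x - y)) \<le> 1 * norm (a x - y)"
        by (rule order_trans[OF norm_blinfun])
          (intro mult_right_mono norm_id_minus_trunc_op_le norm_ge_zero)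
      finally show "norm (((trunc_op k o\<^sub>L a) - a) x) \<le> 2 * e / 3"
        using net y_in y_near by (fastforce simp: dist_norm norm_minus_commute)
    qed (use e_pos in simp)
    with e_pos show "dist (trunc_op k o\<^sub>L a) a < e" by (simp add: dist_norm)
  qed
qed

lemma clinear_blinfun_sum:
  assumes "clinear_on UNIV (blinfun_apply T)"
  shows "blinfun_apply T (\<Sum>q\<in>J. t q *\<^sub>C x q) = (\<Sum>q\<in>J. t q *\<^sub>C blinfun_apply T (x q))"
  using assms by (simp add: blinfun.sum_right clinear_on_def)

lemma clinear_blinfun_of_coords:
  assumes "clinear_on UNIV (blinfun_apply T)"
  shows "blinfun_apply T (ell2_of_coords k f) = (\<Sum>q<k. f q *\<^sub>C blinfun_apply T (ell2_basis q))"
  unfolding ell2_of_coords_def by (rule clinear_blinfun_sum[OF assms])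

lemma clinear_functional_coords_square_summable:
  fixes \<phi> :: "ell2 \<Rightarrow>\<^sub>L complex"
  assumes "clinear_on UNIV (blinfun_apply \<phi>)"
  shows "summable (\<lambda>q. (cmod (\<phi> (ell2_basis q)))\<^sup>2)"
proof (rule summableI_nonneg_bounded[where x = "(norm \<phi>)\<^sup>2"])
  fix k
  define v where "v = ell2_of_coords k (\<lambda>q. cnj (\<phi> (ell2_basis q)))"
  let ?N = "cnorm_on {..<k} (\<lambda>q. \<phi> (ell2_basis q))"
  have norm_v: "norm v = ?N"
    by (simp add: v_def norm_ell2_of_coords cnorm_on_def)
  have "\<phi> v = cinner_on {..<k} (\<lambda>q. \<phi> (ell2_basis q)) (\<lambda>q. \<phi> (ell2_basis q))"
    unfolding v_def clinear_blinfun_of_coords[OF assms]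
    by (simp add: scaleC_complex_def cinner_on_def)
  then have "?N * ?N \<le> norm \<phi> * ?N"
    using norm_blinfun[of \<phi> v] by (simp add: cmod_cinner_on_self norm_v power2_eq_square)
  then have "?N \<le> norm \<phi>"
    using cnorm_on_nonneg[of "{..<k}"] by (smt (verit) mult_le_cancel_right norm_ge_zero)
  then show "(\<Sum>q<k. (cmod (\<phi> (ell2_basis q)))\<^sup>2) \<le> (norm \<phi>)\<^sup>2"
    unfolding cnorm_on_power2[symmetric] by (intro power_mono) auto
qed simp

lemma clinear_functional_tail_le:
  fixes \<phi> :: "ell2 \<Rightarrow>\<^sub>L complex"
  assumes clinear_\<phi>: "clinear_on UNIV (blinfun_apply \<phi>)"
    and r_coords: "\<And>q. ell2_nth r q = \<phi> (ell2_basis q)"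
  shows "norm (\<phi> o\<^sub>L (id_blinfun - trunc_op k)) \<le> norm (r - trunc_op k r)"
proof (rule norm_blinfun_bound)
  fix x
  have block: "cmod (\<phi> (trunc_op Q x - trunc_op k x)) \<le> norm (r - trunc_op k r) * norm x"
    if "k \<le> Q" for Q
  proof -
    have "\<phi> (trunc_op Q x - trunc_op k x) = (\<Sum>q\<in>{k..<Q}. ell2_nth x q * ell2_nth r q)"
      unfolding blinfun.diff_right trunc_op.rep_eq clinear_blinfun_of_coords[OF clinear_\<phi>]
        r_coords scaleC_complex_def lessThan_atLeast0
      using sum.atLeastLessThan_concat[of 0 k Q "\<lambda>q. ell2_nth x q * \<phi> (ell2_basis q)"] that
      by (simp add: algebra_simps)
    also have "\<dots> = (\<Sum>q\<in>{k..<Q}. ell2_nth x q * ell2_nth (r - trunc_op k r) q)"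
      by (intro sum.cong) (auto simp: minus_ell2.rep_eq ell2_nth_trunc_op)
    also have "cmod \<dots> \<le>
        (\<Sum>q\<in>{k..<Q}. \<bar>cmod (ell2_nth (r - trunc_op k r) q)\<bar> * \<bar>cmod (ell2_nth x q)\<bar>)"
      by (rule order_trans[OF norm_sum]) (simp add: norm_mult mult.commute)
    also have "\<dots> \<le> cnorm_on {k..<Q} (ell2_nth (r - trunc_op k r)) * cnorm_on {k..<Q} (ell2_nth x)"
      unfolding cnorm_on_def by (rule L2_set_mult_ineq)
    also have "\<dots> \<le> norm (r - trunc_op k r) * norm x"
      by (intro mult_mono cnorm_on_ell2_nth_le) auto
    finally show ?thesis .
  qed
  have "(\<lambda>Q. cmod (\<phi> (trunc_op Q x - trunc_op k x))) \<longlonglongrightarrow> cmod (\<phi> (x - trunc_op k x))"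
    by (intro tendsto_intros trunc_op_tendsto)
  then have "cmod (\<phi> (x - trunc_op k x)) \<le> norm (r - trunc_op k r) * norm x"
    by (rule LIMSEQ_le_const2) (use block in blast)
  then show "norm ((\<phi> o\<^sub>L (id_blinfun - trunc_op k)) x) \<le> norm (r - trunc_op k r) * norm x"
    by (simp add: blinfun.diff_left)
qed simp

lemma clinear_functional_tail_tendsto_0:
  fixes \<phi> :: "ell2 \<Rightarrow>\<^sub>L complex"
  assumes "clinear_on UNIV (blinfun_apply \<phi>)"
  shows "(\<lambda>k. norm (\<phi> o\<^sub>L (id_blinfun - trunc_op k))) \<longlonglongrightarrow> 0"
proof -
  define r where "r = Abs_ell2 (\<lambda>q. \<phi> (ell2_basis q))"
  have "ell2_nth r q = \<phi> (ell2_basis q)" for q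
    unfolding r_def using clinear_functional_coords_square_summable[OF assms]
    by (subst Abs_ell2_inverse) auto
  note tail_le = clinear_functional_tail_le[OF assms this]
  have "(\<lambda>k. norm (r - trunc_op k r)) \<longlonglongrightarrow> norm (r - r)"
    by (intro tendsto_intros trunc_op_tendsto)
  then have "(\<lambda>k. norm (r - trunc_op k r)) \<longlonglongrightarrow> 0" by simp
  then show ?thesis by (rule Lim_null_comparison[rotated]) (simp add: tail_le)
qed

lemma clinear_trunc_tail_tendsto_0:
  assumes clinear_a: "clinear_on UNIV (blinfun_apply a)"
  shows "(\<lambda>k. norm (trunc_op l o\<^sub>L a o\<^sub>L (id_blinfun - trunc_op k))) \<longlonglongrightarrow> 0"
proof -
  let ?Q = "\<lambda>k. id_blinfun - trunc_op k"
  have row_clinear: "clinear_on UNIV (blinfun_apply (coord_op j o\<^sub>L a))" for j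
    using clinear_a
    by (simp add: clinear_on_def coord_op.rep_eq plus_ell2.rep_eq scaleC_ell2.rep_eq
        scaleC_complex_def)
  have rows: "norm (trunc_op l o\<^sub>L a o\<^sub>L ?Q k) \<le> (\<Sum>j<l. norm (coord_op j o\<^sub>L a o\<^sub>L ?Q k))" for k
  proof (rule norm_blinfun_bound)
    fix x
    have "norm ((trunc_op l o\<^sub>L a o\<^sub>L ?Q k) x) \<le> (\<Sum>j<l. cmod ((coord_op j o\<^sub>L a o\<^sub>L ?Q k) x))"
      by (simp add: trunc_op.rep_eq norm_ell2_of_coords cnorm_on_def coord_op.rep_eq L2_set_le_sum)
    also have "\<dots> \<le> (\<Sum>j<l. norm (coord_op j o\<^sub>L a o\<^sub>L ?Q k)) * norm x"
      unfolding sum_distrib_right by (intro sum_mono norm_blinfun)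
    finally show "norm ((trunc_op l o\<^sub>L a o\<^sub>L ?Q k) x) \<le>
        (\<Sum>j<l. norm (coord_op j o\<^sub>L a o\<^sub>L ?Q k)) * norm x" .
  qed (simp add: sum_nonneg)
  have "(\<lambda>k. \<Sum>j<l. norm (coord_op j o\<^sub>L a o\<^sub>L ?Q k)) \<longlonglongrightarrow> 0"
    by (intro tendsto_null_sum clinear_functional_tail_tendsto_0 row_clinear)
  then show ?thesis
    by (rule Lim_null_comparison[rotated]) (simp add: rows)
qed

lemma compact_operator_tail_tendsto_0:
  assumes compact_a: "a \<in> compact_operators"
  shows "(\<lambda>k. norm (a o\<^sub>L (id_blinfun - trunc_op k))) \<longlonglongrightarrow> 0"
proof (rule tendstoI)
  fix e :: real assume e_pos: "0 < e"
  let ?Q = "\<lambda>k. id_blinfun - trunc_op k"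
  have "\<forall>\<^sub>F l in sequentially. dist (trunc_op l o\<^sub>L a) a < e / 2"
    using e_pos by (intro tendstoD compact_operator_trunc_left_tendsto compact_a) simp
  then obtain l where l_near: "norm (a - (trunc_op l o\<^sub>L a)) < e / 2"
    by (auto simp: eventually_sequentially dist_norm norm_minus_commute)
  have "clinear_on UNIV (blinfun_apply a)" using compact_a by (simp add: compact_operators_def)
  from tendstoD[OF clinear_trunc_tail_tendsto_0[OF this, of l], of "e / 2"] e_pos
  have "\<forall>\<^sub>F k in sequentially. norm (trunc_op l o\<^sub>L a o\<^sub>L ?Q k) < e / 2"
    by simp
  then show "\<forall>\<^sub>F k in sequentially. dist (norm (a o\<^sub>L ?Q k)) 0 < e"
  proof eventually_elim
    fix k assume tail: "norm (trunc_op l o\<^sub>L a o\<^sub>L ?Q k) < e / 2"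
    have "norm ((a - (trunc_op l o\<^sub>L a)) o\<^sub>L ?Q k) \<le> norm (a - (trunc_op l o\<^sub>L a)) * 1"
      by (rule order_trans[OF norm_blinfun_compose])
        (intro mult_left_mono norm_id_minus_trunc_op_le norm_ge_zero)
    moreover have "a o\<^sub>L ?Q k = ((a - (trunc_op l o\<^sub>L a)) o\<^sub>L ?Q k) + (trunc_op l o\<^sub>L a o\<^sub>L ?Q k)"
      by (rule blinfun_eqI) (simp add: blinfun.diff_left blinfun.add_left)
    then have "norm (a o\<^sub>L ?Q k) \<le>
        norm ((a - (trunc_op l o\<^sub>L a)) o\<^sub>L ?Q k) + norm (trunc_op l o\<^sub>L a o\<^sub>L ?Q k)"
      by (metis norm_triangle_ineq)
    ultimately show "dist (norm (a o\<^sub>L ?Q k)) 0 < e" using l_near tail by simp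
  qed
qed

lemma compact_operator_compress_tendsto:
  assumes compact_a: "a \<in> compact_operators"
  shows "(\<lambda>k. compress k a) \<longlonglongrightarrow> a"
proof -
  let ?Q = "\<lambda>k. id_blinfun - trunc_op k"
  have split: "norm (compress k a - a) \<le> norm ((trunc_op k o\<^sub>L a) - a) + norm (a o\<^sub>L ?Q k)" for k
  proof -
    have "norm (trunc_op k o\<^sub>L (a o\<^sub>L ?Q k)) \<le> 1 * norm (a o\<^sub>L ?Q k)"
      by (rule order_trans[OF norm_blinfun_compose])
        (intro mult_right_mono norm_trunc_op_le norm_ge_zero)
    moreover have "compress k a - a = ((trunc_op k o\<^sub>L a) - a) - (trunc_op k o\<^sub>L (a o\<^sub>L ?Q k))"
      by (rule blinfun_eqI) (simp add: blinfun.diff_left blinfun.diff_right)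
    then have "norm (compress k a - a) \<le>
        norm ((trunc_op k o\<^sub>L a) - a) + norm (trunc_op k o\<^sub>L (a o\<^sub>L ?Q k))"
      by (metis norm_triangle_ineq4)
    ultimately show ?thesis by simp
  qed
  have "(\<lambda>k. norm ((trunc_op k o\<^sub>L a) - a) + norm (a o\<^sub>L ?Q k)) \<longlonglongrightarrow> norm (a - a) + 0"
    by (intro tendsto_intros compact_operator_trunc_left_tendsto compact_operator_tail_tendsto_0
        compact_a)
  then have "(\<lambda>k. norm ((trunc_op k o\<^sub>L a) - a) + norm (a o\<^sub>L ?Q k)) \<longlonglongrightarrow> 0" by simp
  then have "(\<lambda>k. compress k a - a) \<longlonglongrightarrow> 0"
    by (rule Lim_null_comparison[rotated]) (simp add: split)
  then show ?thesis by (simp add: LIM_zero_iff)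
qed

section \<open>Tensor sums with operators on \<open>\<ell>\<^sub>2\<close>\<close>

text \<open>\<open>ell2_norm_le n a S y r\<close> states \<open>\<parallel>\<Sum> a\<^sub>c \<otimes> y\<^sub>c\<parallel> \<le> r\<close> for operators \<open>a\<^sub>c\<close> on \<open>\<ell>\<^sub>2\<close>.\<close>

definition ell2_norm_le ::
  "nat \<Rightarrow> (nat \<Rightarrow> ell2 \<Rightarrow>\<^sub>L ell2) \<Rightarrow> 'v set \<Rightarrow> (nat \<Rightarrow> 'v \<Rightarrow> 'v \<Rightarrow> complex) \<Rightarrow> real \<Rightarrow> bool" where
  "ell2_norm_le n a S y r \<longleftrightarrow>
    (\<forall>x. L2_set (\<lambda>s. norm (\<Sum>c<n. a c (\<Sum>t\<in>S. y c s t *\<^sub>C x t))) S \<le> r * L2_set (\<lambda>t. norm (x t)) S)"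

definition op_entries :: "(ell2 \<Rightarrow>\<^sub>L ell2) \<Rightarrow> nat \<Rightarrow> nat \<Rightarrow> complex" where
  "op_entries a p q = ell2_nth (a (ell2_basis q)) p"

lemma ell2_nth_clinear_of_coords:
  assumes "clinear_on UNIV (blinfun_apply a)"
  shows "ell2_nth (a (ell2_of_coords k f)) p = mat_vec {..<k} (op_entries a) f p"
  by (simp add: clinear_blinfun_of_coords[OF assms] ell2_nth_sum scaleC_ell2.rep_eq op_entries_def
      mat_vec_def mult.commute)

lemma cnorm_on_Times_swap: "cnorm_on (A \<times> V) f = L2_set (\<lambda>v. cnorm_on A (\<lambda>p. f (p, v))) V"
  unfolding L2_set_def cnorm_on_Times_power2_swap[symmetric] by simp

lemma mat_norm_le_compression:
  fixes S :: "'v set"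
  assumes clinear_a: "\<And>c. c < n \<Longrightarrow> clinear_on UNIV (blinfun_apply (a c))"
    and y_le: "ell2_norm_le n a S y r"
  shows "mat_norm_le ({..<k} \<times> S) (tensor_sum n (\<lambda>c. op_entries (a c)) y) r"
  unfolding mat_norm_le_def
proof
  fix f :: "nat \<times> 'v \<Rightarrow> complex"
  let ?S = "{..<k} \<times> S" and ?b = "\<lambda>c. op_entries (a c)"
  define x where "x t = ell2_of_coords k (\<lambda>q. f (q, t))" for t
  define g where "g s = (\<Sum>c<n. a c (\<Sum>t\<in>S. y c s t *\<^sub>C x t))" for s
  have g_nth: "ell2_nth (g s) p = mat_vec ?S (tensor_sum n ?b y) f (p, s)" for s p
  proof -
    have "ell2_nth (a c (\<Sum>t\<in>S. y c s t *\<^sub>C x t)) p =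
        (\<Sum>t\<in>S. y c s t * mat_vec {..<k} (?b c) (\<lambda>q. f (q, t)) p)" if "c < n" for c
      by (simp add: clinear_blinfun_sum[OF clinear_a[OF that]] ell2_nth_sum scaleC_ell2.rep_eq x_def
          ell2_nth_clinear_of_coords[OF clinear_a[OF that]])
    then show ?thesis by (simp add: g_def ell2_nth_sum mat_vec_tensor_sum_swap)
  qed
  have "cnorm_on ?S (mat_vec ?S (tensor_sum n ?b y) f) =
      L2_set (\<lambda>s. cnorm_on {..<k} (ell2_nth (g s))) S"
    unfolding cnorm_on_Times_swap by (simp add: g_nth[symmetric])
  also have "\<dots> \<le> L2_set (\<lambda>s. norm (g s)) S"
    by (intro L2_set_mono cnorm_on_ell2_nth_le cnorm_on_nonneg) simp
  also have "\<dots> \<le> r * L2_set (\<lambda>t. norm (x t)) S"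
    using y_le by (simp add: ell2_norm_le_def g_def)
  also have "L2_set (\<lambda>t. norm (x t)) S = cnorm_on ?S f"
    by (simp add: x_def norm_ell2_of_coords cnorm_on_Times_swap)
  finally show "cnorm_on ?S (mat_vec ?S (tensor_sum n ?b y) f) \<le> r * cnorm_on ?S f" .
qed

lemma ell2_norm_le_compress:
  fixes V :: "'v set"
  assumes clinear_a: "\<And>c. c < n \<Longrightarrow> clinear_on UNIV (blinfun_apply (a c))" and r_nonneg: "0 \<le> r"
    and y_le: "mat_norm_le ({..<k} \<times> V) (tensor_sum n (\<lambda>c. op_entries (a c)) y) r"
  shows "ell2_norm_le n (\<lambda>c. compress k (a c)) V y r"
  unfolding ell2_norm_le_def
proof
  fix x :: "'v \<Rightarrow> ell2"
  let ?S = "{..<k} \<times> V" and ?T = "tensor_sum n (\<lambda>c. op_entries (a c)) y"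
  define f where "f = (\<lambda>(q, t). ell2_nth (x t) q)"
  define g where "g s = (\<Sum>c<n. compress k (a c) (\<Sum>t\<in>V. y c s t *\<^sub>C x t))" for s
  have g_nth: "ell2_nth (g s) p = (if p < k then mat_vec ?S ?T f (p, s) else 0)" for s p
  proof -
    have coords: "ell2_nth (\<Sum>t\<in>V. y c s t *\<^sub>C x t) = (\<lambda>q. mat_vec V (y c) (\<lambda>t. f (q, t)) s)" for c
      by (simp add: fun_eq_iff ell2_nth_sum scaleC_ell2.rep_eq f_def mat_vec_def)
    have "ell2_nth (a c (trunc_op k (\<Sum>t\<in>V. y c s t *\<^sub>C x t))) p =
        (\<Sum>q<k. op_entries (a c) p q * mat_vec V (y c) (\<lambda>t. f (q, t)) s)" if "c < n" for c
      unfolding trunc_op.rep_eq coords ell2_nth_clinear_of_coords[OF clinear_a[OF that]]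
      by (simp add: mat_vec_def)
    then show ?thesis by (simp add: g_def ell2_nth_sum ell2_nth_trunc_op mat_vec_tensor_sum)
  qed
  have "norm (g s) = cnorm_on {..<k} (\<lambda>p. mat_vec ?S ?T f (p, s))" for s
    by (subst norm_ell2_finite[of k]) (auto simp: g_nth intro: cnorm_on_cong)
  then have "L2_set (\<lambda>s. norm (g s)) V = cnorm_on ?S (mat_vec ?S ?T f)"
    by (simp add: cnorm_on_Times_swap)
  also have "\<dots> \<le> r * cnorm_on ?S f" by (rule mat_norm_leD[OF y_le])
  also have "\<dots> \<le> r * L2_set (\<lambda>t. norm (x t)) V"
    unfolding cnorm_on_Times_swap f_def prod.case
    by (intro mult_left_mono L2_set_mono cnorm_on_ell2_nth_le cnorm_on_nonneg r_nonneg) simp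
  finally show "L2_set (\<lambda>s. norm (\<Sum>c<n. compress k (a c) (\<Sum>t\<in>V. y c s t *\<^sub>C x t))) V
      \<le> r * L2_set (\<lambda>t. norm (x t)) V"
    by (simp add: g_def)
qed

lemma L2_set_norm_mat_vec_ell2_le:
  fixes x :: "'v \<Rightarrow> ell2"
  assumes A_le: "mat_norm_le V A r" and r_nonneg: "0 \<le> r"
  shows "L2_set (\<lambda>v. norm (\<Sum>w\<in>V. A v w *\<^sub>C x w)) V \<le> r * L2_set (\<lambda>w. norm (x w)) V"
proof -
  have norm_sum: "(\<Sum>v\<in>V. (norm (y v))\<^sup>2) = (\<Sum>i. (cnorm_on V (\<lambda>v. ell2_nth (y v) i))\<^sup>2)" for y
    unfolding norm_ell2_power2 cnorm_on_power2 by (rule suminf_sum[symmetric]) (rule summable_ell2)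
  have summable: "summable (\<lambda>i. (cnorm_on V (\<lambda>v. ell2_nth (y v) i))\<^sup>2)" for y
    unfolding cnorm_on_power2 by (intro summable_sum summable_ell2)
  have coord: "(\<lambda>v. ell2_nth (\<Sum>w\<in>V. A v w *\<^sub>C x w) i) = mat_vec V A (\<lambda>w. ell2_nth (x w) i)" for i
    by (simp add: fun_eq_iff ell2_nth_sum scaleC_ell2.rep_eq mat_vec_def)
  have "(\<Sum>v\<in>V. (norm (\<Sum>w\<in>V. A v w *\<^sub>C x w))\<^sup>2) \<le> (\<Sum>i. r\<^sup>2 * (cnorm_on V (\<lambda>v. ell2_nth (x v) i))\<^sup>2)"
    unfolding norm_sum
    using power_mono[OF mat_norm_leD[OF A_le] cnorm_on_nonneg, of _ 2]
      summable[of "\<lambda>v. \<Sum>w\<in>V. A v w *\<^sub>C x w"]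
    by (intro suminf_le summable_mult summable) (auto simp: coord power_mult_distrib)
  also have "\<dots> = r\<^sup>2 * (\<Sum>v\<in>V. (norm (x v))\<^sup>2)"
    unfolding norm_sum by (rule suminf_mult[OF summable])
  finally show ?thesis
    using real_sqrt_le_mono r_nonneg by (fastforce simp: L2_set_def real_sqrt_mult)
qed

lemma ell2_norm_le_perturb:
  fixes V :: "'v set"
  assumes b_le: "ell2_norm_le n b V y r" and contractive: "\<And>c. c < n \<Longrightarrow> mat_norm_le V (y c) 1"
    and near: "\<And>c. c < n \<Longrightarrow> norm (a c - b c) \<le> \<eta>"
  shows "ell2_norm_le n a V y (r + real n * \<eta>)"
  unfolding ell2_norm_le_def
proof
  fix x :: "'v \<Rightarrow> ell2"
  let ?X = "L2_set (\<lambda>t. norm (x t)) V"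
  define w where "w c s = (\<Sum>t\<in>V. y c s t *\<^sub>C x t)" for c s
  have error_le: "L2_set (\<lambda>s. norm ((a c - b c) (w c s))) V \<le> \<eta> * ?X" if c_less: "c < n" for c
  proof -
    have \<eta>_nonneg: "0 \<le> \<eta>" using near[OF c_less] norm_ge_zero order_trans by blast
    have "L2_set (\<lambda>s. norm ((a c - b c) (w c s))) V \<le> L2_set (\<lambda>s. \<eta> * norm (w c s)) V"
      by (intro L2_set_mono order_trans[OF norm_blinfun] mult_right_mono near c_less norm_ge_zero)
    also have "\<dots> = \<eta> * L2_set (\<lambda>s. norm (w c s)) V"
      using \<eta>_nonneg by (simp add: L2_set_right_distrib)
    also have "\<dots> \<le> \<eta> * ?X"
      using L2_set_norm_mat_vec_ell2_le[OF contractive[OF c_less]] \<eta>_nonneg unfolding w_def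
      by (intro mult_left_mono) auto
    finally show ?thesis .
  qed
  have "L2_set (\<lambda>s. norm (\<Sum>c<n. a c (w c s))) V \<le>
      L2_set (\<lambda>s. norm (\<Sum>c<n. b c (w c s)) + norm (\<Sum>c<n. (a c - b c) (w c s))) V"
    by (intro L2_set_mono norm_ge_zero order_trans[OF _ norm_triangle_ineq])
      (simp add: blinfun.diff_left sum_subtractf)
  also have "\<dots> \<le>
      L2_set (\<lambda>s. norm (\<Sum>c<n. b c (w c s))) V + L2_set (\<lambda>s. norm (\<Sum>c<n. (a c - b c) (w c s))) V"
    by (rule L2_set_triangle_ineq)
  also have "\<dots> \<le> r * ?X + (\<Sum>c<n. \<eta> * ?X)"
  proof (rule add_mono)
    show "L2_set (\<lambda>s. norm (\<Sum>c<n. b c (w c s))) V \<le> r * ?X"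
      using b_le by (simp add: ell2_norm_le_def w_def)
    show "L2_set (\<lambda>s. norm (\<Sum>c<n. (a c - b c) (w c s))) V \<le> (\<Sum>c<n. \<eta> * ?X)"
      using error_le by (intro order_trans[OF L2_set_norm_sum_le] sum_mono) auto
  qed
  finally show "L2_set (\<lambda>s. norm (\<Sum>c<n. a c (\<Sum>t\<in>V. y c s t *\<^sub>C x t))) V \<le> (r + real n * \<eta>) * ?X"
    by (simp add: w_def algebra_simps)
qed

lemma ell2_norm_le_reindex:
  assumes bij_h: "bij_betw h S T"
  shows "ell2_norm_le n a S (\<lambda>c v w. y c (h v) (h w)) r \<longleftrightarrow> ell2_norm_le n a T y r"
    (is "?S \<longleftrightarrow> ?T")
proof
  note T_norm = L2_set_reindex_bij_betw[OF bij_h]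
  have T_sum: "(\<Sum>w\<in>T. g w) = (\<Sum>w\<in>S. g (h w))" for g :: "_ \<Rightarrow> ell2"
    by (simp add: sum.reindex_bij_betw[OF bij_h])
  show ?T if ?S
    using that by (simp add: ell2_norm_le_def T_norm T_sum)
  show ?S if ?T
    unfolding ell2_norm_le_def
  proof
    fix x
    have inv: "inv_into S h (h v) = v" if "v \<in> S" for v
      using bij_betw_inv_into_left[OF bij_h that] .
    show "L2_set (\<lambda>s. norm (\<Sum>c<n. a c (\<Sum>t\<in>S. y c (h s) (h t) *\<^sub>C x t))) S \<le>
        r * L2_set (\<lambda>t. norm (x t)) S"
      using \<open>?T\<close>[unfolded ell2_norm_le_def T_norm T_sum, rule_format, of "\<lambda>w. x (inv_into S h w)"]
      by (simp add: inv cong: L2_set_cong sum.cong)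
  qed
qed

lemma ell2_norm_le_divide_iff:
  assumes t_pos: "0 < t"
  shows "ell2_norm_le n a S (\<lambda>c v w. y c v w / complex_of_real t) r \<longleftrightarrow> ell2_norm_le n a S y (t * r)"
proof -
  have "L2_set (\<lambda>v. norm (\<Sum>c<n. a c (\<Sum>w\<in>S. (y c v w / complex_of_real t) *\<^sub>C x w))) S =
      L2_set (\<lambda>v. norm (\<Sum>c<n. a c (\<Sum>w\<in>S. y c v w *\<^sub>C x w))) S / t" for x
  proof -
    let ?g = "\<lambda>v. \<Sum>c<n. a c (\<Sum>w\<in>S. y c v w *\<^sub>C x w)"
    have "(y c v w / complex_of_real t) *\<^sub>C x w = (1 / t) *\<^sub>R (y c v w *\<^sub>C x w)" for c v w
      by (simp add: scaleR_scaleC scaleC_scaleC)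
    then have "(\<Sum>c<n. a c (\<Sum>w\<in>S. (y c v w / complex_of_real t) *\<^sub>C x w)) = (1 / t) *\<^sub>R ?g v" for v
      by (simp only: scaleR_sum_right[symmetric] blinfun.scaleR_right)
    then show ?thesis
      using t_pos L2_set_right_distrib[of "1 / t" "\<lambda>v. norm (?g v)" S]
      by (simp only: norm_scaleR) simp
  qed
  then show ?thesis by (simp only: ell2_norm_le_def pos_divide_le_eq[OF t_pos] mult_ac)
qed

lemma os_norm_concrete_opspace_tensor_le_iff:
  assumes clinear_a: "\<And>c. c < n \<Longrightarrow> clinear_on UNIV (blinfun_apply (a c))" and r_nonneg: "0 \<le> r"
  shows "os_norm (concrete_opspace F) m (\<lambda>s t. \<Sum>c<n. y c s t *\<^sub>C a c) \<le> ereal r \<longleftrightarrow>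
    ell2_norm_le n a {..<m} y r"
proof -
  have "(\<Sum>t<m. (\<Sum>c<n. y c s t *\<^sub>C a c) (x t)) = (\<Sum>c<n. a c (\<Sum>t<m. y c s t *\<^sub>C x t))" for s x
  proof -
    have "(\<Sum>t<m. (\<Sum>c<n. y c s t *\<^sub>C a c) (x t)) = (\<Sum>c<n. \<Sum>t<m. y c s t *\<^sub>C a c (x t))"
      by (subst sum.swap) (simp add: blinfun.sum_left scaleC_blinfun.rep_eq)
    also have "\<dots> = (\<Sum>c<n. a c (\<Sum>t<m. y c s t *\<^sub>C x t))"
      by (intro sum.cong refl) (simp add: clinear_blinfun_sum clinear_a)
    finally show ?thesis .
  qed
  then show ?thesis by (simp add: os_norm_concrete_opspace_le_iff[OF r_nonneg] ell2_norm_le_def)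
qed

lemma os_norm_concrete_opspace_enumeration_le_iff:
  assumes "\<And>c. c < n \<Longrightarrow> clinear_on UNIV (blinfun_apply (a c))"
    and "bij_betw h {..<m} S" "0 < t" "0 \<le> r"
  shows "os_norm (concrete_opspace F) m
        (\<lambda>i j. \<Sum>c<n. (y c (h i) (h j) / complex_of_real t) *\<^sub>C a c) \<le> ereal r \<longleftrightarrow>
    ell2_norm_le n a S y (t * r)"
  using assms
  by (simp add: os_norm_concrete_opspace_tensor_le_iff ell2_norm_le_divide_iff
      ell2_norm_le_reindex[OF assms(2)])

section \<open>Isomorphisms onto spaces of compact operators\<close>

lemma os_norm_le_cb_norm:
  assumes "1 \<le> l" "\<And>i j. i < l \<Longrightarrow> j < l \<Longrightarrow> X i j \<in> os_carrier E" "os_norm E l X \<le> 1"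
  shows "os_norm F l (\<lambda>i j. u (X i j)) \<le> cb_norm E F u"
  unfolding cb_norm_def using assms by (intro SUP_upper2[of l] SUP_upper2[of X]) auto

lemma scaleC_zero_left: "0 *\<^sub>C x = (0::'a::complex_vector)"
  using scaleC_add_left[of 0 0 x] by simp

lemma clinear_on_diag_functional:
  fixes u :: "((nat \<Rightarrow> nat \<Rightarrow> complex) \<Rightarrow> complex) \<Rightarrow> 'b::complex_vector"
  assumes clinear_u: "clinear_on (os_carrier (E1 n)) u"
  shows "u (diag_functional n t) = (\<Sum>c<n. t c *\<^sub>C u (diag_functional n (basis_vec c)))"
proof -
  have add: "diag_functional n s + diag_functional n t = diag_functional n (\<lambda>c. s c + t c)" for s t
    by (rule ext) (simp add: diag_functional_def algebra_simps sum.distrib)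
  have u_add: "u (diag_functional n (\<lambda>c. s c + t c)) =
      u (diag_functional n s) + u (diag_functional n t)" for s t
    using clinear_u diag_functional_in_carrier unfolding clinear_on_def add[symmetric] by blast
  have scale: "b *\<^sub>C diag_functional n t = diag_functional n (\<lambda>c. b * t c)" for b t
    by (rule ext)
      (simp add: diag_functional_def scaleC_fun_def scaleC_complex_def sum_distrib_left mult.assoc)
  have u_scale: "u (diag_functional n (\<lambda>c. b * t c)) = b *\<^sub>C u (diag_functional n t)" for b t
    using clinear_u diag_functional_in_carrier unfolding clinear_on_def scale[symmetric] by blast
  have "u (diag_functional n (\<lambda>c. \<Sum>j<l. t j * basis_vec j c)) =
      (\<Sum>j<l. t j *\<^sub>C u (diag_functional n (basis_vec j)))" for l
  proof (induction l)
    case 0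
    show ?case using u_scale[of 0 t] by (simp add: scaleC_zero_left)
  qed (simp add: u_add u_scale)
  moreover have "diag_functional n t = diag_functional n (\<lambda>c. \<Sum>j<n. t j * basis_vec j c)"
    by (rule ext)
      (simp add: diag_functional_def basis_vec_def of_bool_def if_distrib[of "\<lambda>x. _ * x"]
        cong: if_cong)
  ultimately show ?thesis by simp
qed

lemma fun_matrix_pairing:
  assumes finite_V: "finite V" and bij_g: "bij_betw g V V"
  shows "(\<Sum>v\<in>V. \<Sum>w\<in>V. fun_matrix g v w * mat_mul V (fun_matrix g) e v w) = mat_trace V e"
proof -
  have g_in: "g v \<in> V" if "v \<in> V" for v using bij_g that by (auto simp: bij_betw_def)
  have "(\<Sum>w\<in>V. fun_matrix g v w * mat_mul V (fun_matrix g) e v w) = e (g v) (g v)" if "v \<in> V" for v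
    using mat_vec_fun_matrix[OF finite_V, of g] g_in[OF that]
    by (simp add: mat_vec_def[symmetric] mat_mul_def)
  then have "(\<Sum>v\<in>V. \<Sum>w\<in>V. fun_matrix g v w * mat_mul V (fun_matrix g) e v w) =
      (\<Sum>v\<in>V. e (g v) (g v))"
    by simp
  also have "\<dots> = mat_trace V e"
    unfolding mat_trace_def by (rule sum.reindex_bij_betw[OF bij_g])
  finally show ?thesis .
qed

lemma ex_power_power2_small:
  fixes K \<theta> \<epsilon> :: real
  assumes "0 \<le> \<theta>" "\<theta> < 1" "0 < \<epsilon>"
  obtains i :: nat where "K * \<theta> ^ (4 * 2 ^ i) \<le> \<epsilon>"
proof -
  have "(\<lambda>i. K * \<theta> ^ i) \<longlonglongrightarrow> K * 0"
    using assms by (intro tendsto_intros LIMSEQ_realpow_zero)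
  then have "\<forall>\<^sub>F i in sequentially. K * \<theta> ^ i < \<epsilon>"
    using assms(3) by (intro order_tendstoD(2)) auto
  then obtain i where small: "\<And>j. i \<le> j \<Longrightarrow> K * \<theta> ^ j < \<epsilon>"
    by (auto simp: eventually_sequentially)
  have "i < 2 ^ i" by (rule less_exp)
  then have "i \<le> 4 * 2 ^ i" by linarith
  then show ?thesis using that small less_imp_le by blast
qed

locale E1_compact_isomorphism =
  fixes n :: nat and F :: "(ell2 \<Rightarrow>\<^sub>L ell2) set"
    and u :: "((nat \<Rightarrow> nat \<Rightarrow> complex) \<Rightarrow> complex) \<Rightarrow> ell2 \<Rightarrow>\<^sub>L ell2"
  assumes n_ge_2: "2 \<le> n" and F_compact: "F \<subseteq> compact_operators"
    and clinear_u: "clinear_on (os_carrier (E1 n)) u" and bij_u: "bij_betw u (os_carrier (E1 n)) F"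
begin

definition basis_image :: "nat \<Rightarrow> ell2 \<Rightarrow>\<^sub>L ell2" where
  "basis_image c = u (diag_functional n (basis_vec c))"

abbreviation "cb_u \<equiv> cb_norm (E1 n) (concrete_opspace F) u"
abbreviation "cb_inv_u \<equiv> cb_norm (concrete_opspace F) (E1 n) (inv_into (os_carrier (E1 n)) u)"

lemma u_diag_functional: "u (diag_functional n t) = (\<Sum>c<n. t c *\<^sub>C basis_image c)"
  unfolding basis_image_def by (rule clinear_on_diag_functional[OF clinear_u])

lemma u_diag_functional_in: "(\<Sum>c<n. t c *\<^sub>C basis_image c) \<in> F"
  using bij_u diag_functional_in_carrier unfolding u_diag_functional[symmetric]
  by (auto simp: bij_betw_def)

lemma inv_u_diag_functional:
  "inv_into (os_carrier (E1 n)) u (\<Sum>c<n. t c *\<^sub>C basis_image c) = diag_functional n t"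
  using bij_u diag_functional_in_carrier by (simp add: bij_betw_def flip: u_diag_functional)

lemma basis_image_compact: "basis_image c \<in> compact_operators"
  using bij_u F_compact diag_functional_in_carrier by (auto simp: basis_image_def bij_betw_def)

lemma basis_image_clinear: "clinear_on UNIV (blinfun_apply (basis_image c))"
  using basis_image_compact by (simp add: compact_operators_def)

lemma ell2_norm_le_of_E1_norm_le:
  assumes cb_u_le: "cb_u \<le> ereal \<alpha>" and \<alpha>_nonneg: "0 \<le> \<alpha>" and finite_S: "finite S"
    and S_nonempty: "S \<noteq> {}"
    and y_le: "E1_norm_le n S y r" and r_pos: "0 < r"
  shows "ell2_norm_le n basis_image S y (r * \<alpha>)"
proof -
  obtain h where bij_h: "bij_betw h {..<card S} S"
    using ex_bij_betw_nat_finite[OF finite_S] by (auto simp: atLeast0LessThan)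
  let ?Y = "\<lambda>i j. diag_functional n (\<lambda>c. y c (h i) (h j) / complex_of_real r)"
  have "os_norm (E1 n) (card S) ?Y \<le> ereal 1"
    using y_le r_pos by (subst os_norm_E1_enumeration_le_iff[OF bij_h]) auto
  then have "os_norm (concrete_opspace F) (card S) (\<lambda>i j. u (?Y i j)) \<le> cb_u"
    using finite_S S_nonempty diag_functional_in_carrier
    by (intro os_norm_le_cb_norm) (auto simp: one_ereal_def Suc_le_eq card_gt_0_iff)
  also note cb_u_le
  finally show ?thesis
    using os_norm_concrete_opspace_enumeration_le_iff[where a = basis_image,
        OF basis_image_clinear bij_h r_pos \<alpha>_nonneg]
    by (simp add: u_diag_functional)
qed

lemma E1_norm_le_of_ell2_norm_le:
  assumes cb_inv_u_le: "cb_inv_u \<le> ereal \<beta>" and \<beta>_nonneg: "0 \<le> \<beta>" and finite_S: "finite S"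
    and S_nonempty: "S \<noteq> {}"
    and y_le: "ell2_norm_le n basis_image S y r" and r_pos: "0 < r"
  shows "E1_norm_le n S y (r * \<beta>)"
proof -
  obtain h where bij_h: "bij_betw h {..<card S} S"
    using ex_bij_betw_nat_finite[OF finite_S] by (auto simp: atLeast0LessThan)
  let ?Y = "\<lambda>i j. \<Sum>c<n. (y c (h i) (h j) / complex_of_real r) *\<^sub>C basis_image c"
  have "os_norm (concrete_opspace F) (card S) ?Y \<le> ereal 1"
    using y_le r_pos
    by (subst os_norm_concrete_opspace_enumeration_le_iff[OF basis_image_clinear bij_h]) auto
  then have "os_norm (E1 n) (card S) (\<lambda>i j. inv_into (os_carrier (E1 n)) u (?Y i j)) \<le> cb_inv_u"
    using finite_S S_nonempty u_diag_functional_in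
    by (intro os_norm_le_cb_norm)
      (auto simp: one_ereal_def Suc_le_eq card_gt_0_iff concrete_opspace_def)
  also note cb_inv_u_le
  finally show ?thesis
    using os_norm_E1_enumeration_le_iff[OF bij_h r_pos \<beta>_nonneg]
    by (simp add: inv_u_diag_functional)
qed

lemma cb_u_pos: "0 < cb_u"
proof (rule ccontr)
  assume "\<not> 0 < cb_u"
  then have zero: "cb_u \<le> ereal 0" by (simp add: zero_ereal_def)
  have "E1_norm_le n {0::nat} (\<lambda>_ _ _. 1) (real n)"
    by (rule E1_norm_le_Schur[where h = "\<lambda>_. 1"]) simp_all
  then have "ell2_norm_le n basis_image {0::nat} (\<lambda>_ _ _. 1) (real n * 0)"
    using n_ge_2 by (intro ell2_norm_le_of_E1_norm_le zero) auto
  then have "(\<Sum>c<n. basis_image c (f 0)) = 0" for f :: "nat \<Rightarrow> ell2"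
    by (simp add: ell2_norm_le_def L2_set_def scaleC_one)
  from this[of "\<lambda>_. x" for x] have "(\<Sum>c<n. basis_image c x) = 0" for x .
  then have "u (diag_functional n (\<lambda>_. 1)) = 0"
    unfolding u_diag_functional by (intro blinfun_eqI) (simp add: scaleC_one blinfun.sum_left)
  moreover have "u (diag_functional n (\<lambda>_. 0)) = 0"
    by (simp add: u_diag_functional scaleC_zero_left)
  ultimately have "diag_functional n (\<lambda>_. 1) = diag_functional n (\<lambda>_. 0)"
    using inj_onD[OF bij_betw_imp_inj_on[OF bij_u]] diag_functional_in_carrier by metis
  moreover define x :: "nat \<Rightarrow> nat \<Rightarrow> complex" where "x i j = of_bool (i = 0 \<and> j = 0)" for i j
  have "x \<in> os_carrier (ell_infty n)" using n_ge_2 by (auto simp: carrier_ell_infty x_def)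
  then have "diag_functional n (\<lambda>_. 1) x = 1" "diag_functional n (\<lambda>_. 0) x = 0"
    using n_ge_2 by (simp_all add: diag_functional_def) (simp add: x_def of_bool_def)
  ultimately show False by simp
qed

lemma cb_inv_u_pos: "0 < cb_inv_u"
proof (rule ccontr)
  assume "\<not> 0 < cb_inv_u"
  then have zero: "cb_inv_u \<le> ereal 0" by (simp add: zero_ereal_def)
  define \<rho> where "\<rho> = (\<Sum>c<n. norm (basis_image c)) + 1"
  have "norm (\<Sum>c<n. basis_image c x) \<le> \<rho> * norm x" for x
  proof -
    have "norm (\<Sum>c<n. basis_image c x) \<le> (\<Sum>c<n. norm (basis_image c) * norm x)"
      by (intro order_trans[OF norm_sum] sum_mono norm_blinfun)
    also have "\<dots> \<le> \<rho> * norm x"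
      unfolding \<rho>_def sum_distrib_right[symmetric] by (intro mult_right_mono) auto
    finally show ?thesis .
  qed
  then have "ell2_norm_le n basis_image {0::nat} (\<lambda>_ _ _. 1) \<rho>"
    by (simp add: ell2_norm_le_def L2_set_def scaleC_one)
  moreover have "0 < \<rho>" unfolding \<rho>_def by (intro add_nonneg_pos sum_nonneg) auto
  ultimately have "E1_norm_le n {0::nat} (\<lambda>_ _ _. 1) (\<rho> * 0)"
    by (intro E1_norm_le_of_ell2_norm_le zero) auto
  from E1_norm_le_pairing[OF _ this, of "\<lambda>_ _ _. 1"] have "real n \<le> 0"
    by (simp add: mat_norm_le_def mat_vec_def cnorm_on_def L2_set_def)
  then show False using n_ge_2 by simp
qed

lemma tree_compression_le:
  assumes cb_u_le: "cb_u \<le> ereal \<alpha>" and \<alpha>_nonneg: "0 \<le> \<alpha>"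
  shows "mat_norm_le ({..<k} \<times> red_words n R)
    (tree_sum n (\<lambda>c. op_entries (basis_image c))) (2 * sqrt (real n - 1) * \<alpha>)"
proof (intro mat_norm_le_compression basis_image_clinear ell2_norm_le_of_E1_norm_le cb_u_le
    \<alpha>_nonneg)
  show "red_words n R \<noteq> {}" using Nil_in_red_words by blast
qed (use n_ge_2 finite_red_words E1_norm_le_tree in auto)

lemma graph_cut_trace_le:
  fixes R :: nat and e
  defines "V \<equiv> ball_perms n R"
  defines "y \<equiv> \<lambda>c. mat_mul V (fun_matrix (perm_edge n R c)) e"
  assumes cb_inv_u_le: "cb_inv_u \<le> ereal \<beta>" and \<beta>_nonneg: "0 \<le> \<beta>"
    and projection_e: "projection_on V e"
    and cut_le: "mat_norm_le ({..<k} \<times> V) (tensor_sum n (\<lambda>c. op_entries (basis_image c)) y) r"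
    and r_pos: "0 < r"
    and near: "\<And>c. c < n \<Longrightarrow> norm (basis_image c - compress k (basis_image c)) \<le> \<epsilon>"
    and \<epsilon>_nonneg: "0 \<le> \<epsilon>"
  shows "real n * cmod (mat_trace V e) \<le> (r + real n * \<epsilon>) * \<beta> * real (card V)"
proof -
  let ?x = "\<lambda>c. fun_matrix (perm_edge n R c)"
  have finite_V: "finite V" and V_nonempty: "V \<noteq> {}"
    using finite_ball_perms card_ball_perms_pos[of n R] by (auto simp: V_def)
  have perm: "bij_betw (perm_edge n R c) V V" for c unfolding V_def by (rule bij_betw_perm_edge)
  note x_contraction = mat_norm_le_fun_matrix[OF finite_V perm]
  have "mat_norm_le V (y c) 1" for c
    using mat_norm_le_mat_mul[OF x_contraction projection_on_mat_norm_le[OF projection_e]]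
    by (simp add: y_def)
  moreover have "ell2_norm_le n (\<lambda>c. compress k (basis_image c)) V y r"
    using r_pos by (intro ell2_norm_le_compress basis_image_clinear cut_le) simp
  ultimately have "ell2_norm_le n basis_image V y (r + real n * \<epsilon>)"
    using near by (intro ell2_norm_le_perturb)
  then have "E1_norm_le n V y ((r + real n * \<epsilon>) * \<beta>)"
    using cut_le r_pos \<epsilon>_nonneg
    by (intro E1_norm_le_of_ell2_norm_le cb_inv_u_le \<beta>_nonneg finite_V V_nonempty)
      (auto intro: add_pos_nonneg)
  from E1_norm_le_pairing[OF finite_V this, of ?x, OF x_contraction]
  show ?thesis
    unfolding y_def using fun_matrix_pairing[OF finite_V perm] by (simp add: norm_mult)
qed

lemma n_le_cb_product_approx:
  assumes cb_u_le: "cb_u \<le> ereal \<alpha>" and \<alpha>_nonneg: "0 \<le> \<alpha>" and cb_inv_u_le: "cb_inv_u \<le> ereal \<beta>"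
    and \<beta>_nonneg: "0 \<le> \<beta>" and \<epsilon>_pos: "0 < \<epsilon>"
  shows "real n * (1 - \<epsilon>) \<le> (2 * sqrt (real n - 1) * \<alpha> + \<epsilon> + real n * \<epsilon>) * \<beta>"
proof -
  define C where "C = 2 * sqrt (real n - 1) * \<alpha>"
  have C_nonneg: "0 \<le> C" using \<alpha>_nonneg n_ge_2 by (simp add: C_def)
  have "\<forall>\<^sub>F k in sequentially. \<forall>c\<in>{..<n}. dist (compress k (basis_image c)) (basis_image c) < \<epsilon>"
    by (intro eventually_ball_finite ballI tendstoD compact_operator_compress_tendsto
        basis_image_compact \<epsilon>_pos) simp
  from eventually_happens'[OF sequentially_bot this]
  obtain k where compress_near: "\<And>c. c < n \<Longrightarrow> norm (basis_image c - compress k (basis_image c)) \<le> \<epsilon>"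
    by (metis dist_commute dist_norm lessThan_iff less_imp_le)
  obtain i :: nat where small: "(real (card {..<k}))\<^sup>2 * (C / (C + \<epsilon>)) ^ (4 * 2 ^ i) \<le> \<epsilon>"
    using ex_power_power2_small[of "C / (C + \<epsilon>)"] C_nonneg \<epsilon>_pos by auto
  let ?V = "ball_perms n (4 * 2 ^ i)"
  note tree_le = tree_compression_le[OF cb_u_le \<alpha>_nonneg, folded C_def]
  obtain e where projection_e: "projection_on ?V e"
    and trace_e: "real (card ?V) * (1 - \<epsilon>) \<le> Re (mat_trace ?V e)"
    and cut_le: "mat_norm_le ({..<k} \<times> ?V) (tensor_sum n (\<lambda>c. op_entries (basis_image c))
      (\<lambda>c. mat_mul ?V (fun_matrix (perm_edge n (4 * 2 ^ i) c)) e)) (C + \<epsilon>)"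
    using projection_cutting_graph[OF finite_lessThan C_nonneg tree_le _ order_refl small]
      C_nonneg \<epsilon>_pos by auto
  have "real n * (1 - \<epsilon>) * real (card ?V) \<le> real n * cmod (mat_trace ?V e)"
    using mult_left_mono[OF order_trans[OF trace_e complex_Re_le_cmod], of "real n"]
    by (simp add: mult_ac)
  also have "\<dots> \<le> (C + \<epsilon> + real n * \<epsilon>) * \<beta> * real (card ?V)"
    using C_nonneg \<epsilon>_pos
    by (intro graph_cut_trace_le[OF cb_inv_u_le \<beta>_nonneg projection_e cut_le _ compress_near]) auto
  finally show ?thesis
    using card_ball_perms_pos[of n "4 * 2 ^ i"] by (simp add: C_def)
qed

lemma cb_product_ge: "ereal (real n / (2 * sqrt (real n - 1))) \<le> cb_u * cb_inv_u"
proof (cases "cb_u = \<infinity> \<or> cb_inv_u = \<infinity>")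
  case True
  then show ?thesis using cb_u_pos cb_inv_u_pos by auto
next
  case False
  then obtain \<alpha> \<beta> where cb_u_eq: "cb_u = ereal \<alpha>" and cb_inv_u_eq: "cb_inv_u = ereal \<beta>"
    using cb_u_pos cb_inv_u_pos by (cases cb_u; cases cb_inv_u) auto
  then have \<alpha>_pos: "0 < \<alpha>" and \<beta>_pos: "0 < \<beta>" using cb_u_pos cb_inv_u_pos by auto
  have "real n * (1 - 0) \<le> (2 * sqrt (real n - 1) * \<alpha> + 0 + real n * 0) * \<beta>"
  proof (rule tendsto_le[OF trivial_limit_at_right_real])
    show "((\<lambda>\<epsilon>. real n * (1 - \<epsilon>)) \<longlongrightarrow> real n * (1 - 0)) (at_right 0)"
      "((\<lambda>\<epsilon>. (2 * sqrt (real n - 1) * \<alpha> + \<epsilon> + real n * \<epsilon>) * \<beta>) \<longlongrightarrow>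
        (2 * sqrt (real n - 1) * \<alpha> + 0 + real n * 0) * \<beta>) (at_right 0)"
      by (intro tendsto_intros)+
    show "\<forall>\<^sub>F \<epsilon> in at_right 0. real n * (1 - \<epsilon>) \<le> (2 * sqrt (real n - 1) * \<alpha> + \<epsilon> + real n * \<epsilon>) * \<beta>"
      using n_le_cb_product_approx cb_u_eq cb_inv_u_eq \<alpha>_pos \<beta>_pos
      by (intro eventually_at_right_less[THEN eventually_mono]) auto
  qed
  then have "real n / (2 * sqrt (real n - 1)) \<le> \<alpha> * \<beta>"
    using n_ge_2 by (simp add: pos_divide_le_eq mult_ac)
  then show ?thesis by (simp add: cb_u_eq cb_inv_u_eq)
qed

end

lemma one_less_div_two_sqrt_pred:
  assumes "3 \<le> n"
  shows "1 < real n / (2 * sqrt (real n - 1))"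
proof -
  have "0 < (real n - 2)\<^sup>2" using assms by simp
  then have "4 * (real n - 1) < (real n)\<^sup>2" by (simp add: power2_eq_square algebra_simps)
  then have "sqrt (4 * (real n - 1)) < real n" using assms by (intro real_less_lsqrt) auto
  then have "2 * sqrt (real n - 1) < real n" by (simp only: real_sqrt_mult real_sqrt_four)
  then show ?thesis using assms by (simp add: pos_less_divide_eq)
qed

lemma d_SK_E1_ge:
  assumes n_ge_2: "2 \<le> n"
  shows "ereal (real n / (2 * sqrt (real n - 1))) \<le> d_SK (E1 n)"
  unfolding d_SK_def d_cb_def
proof (intro INF_greatest)
  fix F u
  assume "F \<in> {F. csubspace F \<and> closed F \<and> F \<subseteq> compact_operators}"
    "u \<in> {u. clinear_on (os_carrier (E1 n)) u \<and>
      bij_betw u (os_carrier (E1 n)) (os_carrier (concrete_opspace F))}"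
  then have "E1_compact_isomorphism n F u"
    using n_ge_2 by unfold_locales (auto simp: concrete_opspace_def)
  then show "ereal (real n / (2 * sqrt (real n - 1))) \<le> cb_norm (E1 n) (concrete_opspace F) u *
      cb_norm (concrete_opspace F) (E1 n) (inv_into (os_carrier (E1 n)) u)"
    by (rule E1_compact_isomorphism.cb_product_ge)
qed

theorem theorem7:
  "(\<forall>n\<ge>2. d_SK (E1 n) \<ge> ereal (real n / (2 * sqrt (real n - 1)))) \<and>
   (\<forall>n\<ge>3. d_SK (E1 n) > 1)"
proof (intro conjI allI impI)
  show "ereal (real n / (2 * sqrt (real n - 1))) \<le> d_SK (E1 n)" if "2 \<le> n" for n
    using that by (rule d_SK_E1_ge)
  show "1 < d_SK (E1 n)" if "3 \<le> n" for n
  proof -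
    have "1 < ereal (real n / (2 * sqrt (real n - 1)))"
      using one_less_div_two_sqrt_pred[OF that] by (simp add: one_ereal_def)
    also have "\<dots> \<le> d_SK (E1 n)" using that by (intro d_SK_E1_ge) simp
    finally show ?thesis .
  qed
qed

end
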